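(* Let $N\ge 1$. Assume $f\in C^0([0,\infty))\cap C^2((0,\infty))$ is nondecreasing and convex, $f>0$ in $(0,\infty)$, and the limit $q_0=\lim_{u\to0^+}q(u)$ exists in $\overline{\mathbb{R}}$. Let $p_0$ be the conjugate exponent of $q_0$, let $\overline{q_\infty}=\limsup_{u\to+\infty}q(u)$, and let $\underline{p_\infty}\in\overline{\mathbb{R}}$ be the conjugate exponent of $\overline{q_\infty}$. Let $u\in C^2(\mathbb{R}^N)$ be a nonnegative, stable solution (not necessarily bounded) of $-\Delta u=f(u)$ in $\mathbb{R}^N$. Then $u\equiv 0$ if any of the following conditions holds: 1. $1\le N\le 9$ and $1<\underline{p_\infty}$; 2. $N=10$, $p_0<+\infty$ and $1<\underline{p_\infty}<+\infty$; 3. $N\ge 11$, $p_0<p_c(N)$ and $1<\underline{p_\infty}<p_c(N)$.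
   Context: For $u>0$, $q(u)=\dfrac{f'(u)^2}{f(u)f''(u)}$ if $f(u)f''(u)\ne0$, and $q(u)=+\infty$ otherwise. The conjugate exponent $p\in\overline{\mathbb{R}}$ of $q$ is defined by $1/p+1/q=1$, i.e. $p=q/(q-1)$ if $q\notin\{1,+\infty\}$, $p=+\infty$ if $q=1$, $p=1$ if $q=+\infty$. For $N\ge 11$, $p_c(N)=\dfrac{(N-2)^2-4N+8\sqrt{N-1}}{(N-2)(N-10)}$. A solution $u\in C^2(\mathbb{R}^N)$ of $-\Delta u=f(u)$ in $\mathbb{R}^N$ is stable if for all $\varphi\in C^1_c(\mathbb{R}^N)$, $\int_{\mathbb{R}^N} f'(u)\varphi^2\,dx\le\int_{\mathbb{R}^N}|\nabla\varphi|^2\,dx$; here $f'(0)$ denotes the right derivative of $f$ at $0$ (which exists and is finite by convexity and monotonicity). *)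

theory Defs
  imports "HOL-Analysis.Analysis"
begin

definition partial_deriv :: "'n::finite \<Rightarrow> (real ^ 'n \<Rightarrow> real) \<Rightarrow> real ^ 'n \<Rightarrow> real" where
  "partial_deriv i u x = frechet_derivative u (at x) (axis i 1)"

definition grad :: "(real ^ 'n::finite \<Rightarrow> real) \<Rightarrow> real ^ 'n \<Rightarrow> real ^ 'n" where
  "grad u x = (\<chi> i. partial_deriv i u x)"

definition laplacian :: "(real ^ 'n::finite \<Rightarrow> real) \<Rightarrow> real ^ 'n \<Rightarrow> real" where
  "laplacian u x = (\<Sum>i\<in>UNIV. partial_deriv i (partial_deriv i u) x)"

definition C1 :: "(real ^ 'n::finite \<Rightarrow> real) \<Rightarrow> bool" where
  "C1 u \<longleftrightarrow> (\<forall>x. u differentiable (at x)) \<and> (\<forall>i. continuous_on UNIV (partial_deriv i u))"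

definition C2 :: "(real ^ 'n::finite \<Rightarrow> real) \<Rightarrow> bool" where
  "C2 u \<longleftrightarrow> C1 u \<and> (\<forall>i. C1 (partial_deriv i u))"

definition C1_compact_support :: "(real ^ 'n::finite \<Rightarrow> real) \<Rightarrow> bool" where
  "C1_compact_support \<phi> \<longleftrightarrow> C1 \<phi> \<and> compact (closure {x. \<phi> x \<noteq> 0})"

text \<open>
  A nonlinearity on \<open>[0,\<infinity>)\<close> is a function on all reals whose values at negative arguments
  are irrelevant. Accordingly its derivative at \<open>0\<close> is the right derivative.
\<close>

definition nonlin_deriv :: "(real \<Rightarrow> real) \<Rightarrow> real \<Rightarrow> real" where
  "nonlin_deriv f s = (if s = 0 then vector_derivative f (at_right 0) else deriv f s)"

definition solution :: "(real \<Rightarrow> real) \<Rightarrow> (real ^ 'n::finite \<Rightarrow> real) \<Rightarrow> bool" where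
  "solution f u \<longleftrightarrow> C2 u \<and> (\<forall>x. - laplacian u x = f (u x))"

text \<open>
  For the nonlinearities of interest (convex, continuous and nondecreasing on \<open>[0,\<infinity>)\<close>,
  \<open>C\<^sup>2\<close> on \<open>(0,\<infinity>)\<close>) and \<open>u \<ge> 0\<close> continuous, both integrands below are continuous with compact
  support, so the integrals are never the default value of a non-integrable function.
\<close>

definition is_stable :: "(real \<Rightarrow> real) \<Rightarrow> (real ^ 'n::finite \<Rightarrow> real) \<Rightarrow> bool" where
  "is_stable f u \<longleftrightarrow>
     (\<forall>\<phi>. C1_compact_support \<phi> \<longrightarrow>
        (LINT x|lborel. nonlin_deriv f (u x) * (\<phi> x)\<^sup>2) \<le> (LINT x|lborel. (norm (grad \<phi> x))\<^sup>2))"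

definition q_fun :: "(real \<Rightarrow> real) \<Rightarrow> real \<Rightarrow> ereal" where
  "q_fun f s =
     (if f s * deriv (deriv f) s \<noteq> 0
      then ereal ((deriv f s)\<^sup>2 / (f s * deriv (deriv f) s)) else \<infinity>)"

text \<open>
  The value at \<open>-\<infinity>\<close> follows the relation \<open>1/p + 1/q = 1\<close>; it does not occur for limits of
  \<open>q_fun f\<close> with \<open>f\<close> nonnegative and convex.
\<close>

definition conj_exponent :: "ereal \<Rightarrow> ereal" where
  "conj_exponent q =
     (if \<bar>q\<bar> = \<infinity> then 1 else if q = 1 then \<infinity> else q / (q - 1))"

definition p_c :: "nat \<Rightarrow> real" where
  "p_c N = ((real N - 2)\<^sup>2 - 4 * real N + 8 * sqrt (real N - 1)) / ((real N - 2) * (real N - 10))"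

end

theory Submission
  imports Defs
begin

text \<open>
  Stability is tested with \<open>\<psi>(u) \<eta>\<close>, where \<open>\<eta>\<close> is a cutoff at scale \<open>R\<close> and \<open>\<psi>\<close> behaves like
  \<open>f powr \<alpha>0\<close> near \<open>0\<close>, like a multiple of \<open>f\<close> in between and like a multiple of \<open>f powr \<alpha>1\<close> near
  infinity. The gradient term is eliminated by testing the equation with \<open>G(u) \<eta>\<^sup>2\<close>,
  \<open>G' = \<psi>'\<^sup>2\<close>, \<open>G 0 = 0\<close>. If \<open>(\<alpha> - 1)\<^sup>2 < 1/q\<close> at both ends, then \<open>f G \<le> (1 - \<epsilon>) f' \<psi>\<^sup>2\<close>
  everywhere; on the middle part, where nothing is known about \<open>q\<close>, the factor \<open>\<psi> = f\<close> just preserves the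
  gap inherited from the part near \<open>0\<close>. Hence \<open>\<integral> f'(u) \<psi>(u)\<^sup>2 \<eta>\<^sup>2 \<le> C R powr (-2) \<integral> \<psi>(u)\<^sup>2 \<dots>\<close>. Since \<open>f'\<close> is bounded
  below by about \<open>f powr (1/q)\<close> at both ends, a pointwise Young inequality, with an exponent depending on
  whether \<open>u\<close> is small or large, bounds the left side by a negative power of \<open>R\<close> as soon as
  \<open>N < 2 + 4 q + 4 sqrt q\<close> for \<open>q = q\<^sub>0\<close> and for \<open>q\<close> the upper limit at infinity, which is what the three cases say.
  If \<open>f 0 > 0\<close> or \<open>q\<^sub>0 = \<infinity>\<close>, then \<open>f s \<ge> c s powr p\<close> for some \<open>p > 1\<close> as close to \<open>1\<close> as desired, and the
  equation tested with \<open>\<eta>\<^sup>2\<close> suffices.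
\<close>

section \<open>Integration by parts\<close>

lemma integrable_continuous_bounded_support:
  fixes g :: "'a::euclidean_space \<Rightarrow> real"
  assumes "continuous_on UNIV g" "\<And>x. R < norm x \<Longrightarrow> g x = 0"
  shows "integrable lborel g"
proof -
  have "integrable lborel (\<lambda>x. indicator (cball 0 R) x *\<^sub>R g x)"
    by (rule borel_integrable_compact) (auto intro: continuous_on_subset[OF assms(1)])
  moreover have "(\<lambda>x. indicator (cball 0 R) x *\<^sub>R g x) = g"
    using assms(2) by (auto simp: indicator_def fun_eq_iff not_le)
  ultimately show ?thesis by simp
qed

text \<open>Difference quotients of \<open>w\<close> have integral \<open>0\<close> by translation invariance.\<close>

lemma integral_directional_derivative_eq_0:
  fixes w :: "'a::euclidean_space \<Rightarrow> real"
  assumes w: "\<And>x. (w has_derivative w' x) (at x)"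
    and cont: "continuous_on UNIV (\<lambda>x. w' x e)"
    and supp: "\<And>x. R < norm x \<Longrightarrow> w x = 0"
  shows "(LINT x|lborel. w' x e) = 0"
proof -
  have contw: "continuous_on UNIV w"
    using w by (meson continuous_at_imp_continuous_on has_derivative_continuous)
  \<comment> \<open>The complement of the ball is open and \<open>w\<close> vanishes on it, hence so
    does its derivative. This makes the bound obtained on the compact ball global.\<close>
  have supp': "w' x e = 0" if "R < norm x" for x
  proof -
    have "open {y::'a. R < norm y}" by (intro open_Collect_less continuous_intros)
    then have "(w has_derivative (\<lambda>_. 0)) (at x)"
      using that supp by (intro has_derivative_transform_within_open[OF has_derivative_const[of 0]]) auto
    then show ?thesis using has_derivative_unique[OF w] by (auto dest: fun_cong)
  qed
  have "bounded ((\<lambda>x. w' x e) ` cball 0 R)"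
    by (intro compact_imp_bounded compact_continuous_image continuous_on_subset[OF cont]) auto
  then obtain B where "B > 0" and B0: "\<And>x. x \<in> cball 0 R \<Longrightarrow> \<bar>w' x e\<bar> \<le> B"
    by (auto simp: bounded_pos)
  have B: "\<bar>w' x e\<bar> \<le> B" for x
    using B0[of x] supp'[of x] \<open>B > 0\<close> by (cases "norm x \<le> R") auto
  \<comment> \<open>Steps of length at most 1 keep the supports of all difference quotients inside
    the ball of radius \<open>R + norm e\<close>, so one integrable majorant serves for all of
    them.\<close>
  define h where "h n = inverse (real (Suc n))" for n
  have h: "h n > 0" "h n \<le> 1" for n by (auto simp: h_def field_simps)
  have h0: "h \<longlonglongrightarrow> 0" unfolding h_def by (rule LIMSEQ_inverse_real_of_nat)
  define g where "g n x = (w (h n *\<^sub>R e + x) - w x) / h n" for n x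
  have int_w: "integrable lborel w"
    using contw supp by (rule integrable_continuous_bounded_support)
  have int_sh: "integrable lborel (\<lambda>x. w (t + x)) \<and> (LINT x|lborel. w (t + x)) = (LINT x|lborel. w x)" for t
  proof -
    have [measurable]: "w \<in> borel_measurable borel" using contw by (simp add: borel_measurable_continuous_onI)
    have "integrable (distr lborel borel ((+) t)) w" using int_w by (simp add: lborel_distr_plus)
    moreover have "(LINT x|lborel. w x) = (LINT x|distr lborel borel ((+) t). w x)"
      by (simp add: lborel_distr_plus)
    ultimately show ?thesis by (simp add: integrable_distr_eq integral_distr)
  qed
  have int_g: "(LINT x|lborel. g n x) = 0" for n
    using int_w int_sh[of "h n *\<^sub>R e"] by (simp add: g_def)
  have "(\<lambda>n. LINT x|lborel. g n x) \<longlonglongrightarrow> (LINT x|lborel. w' x e)"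
  proof (rule integral_dominated_convergence[where w="\<lambda>x. indicator (cball 0 (R + norm e)) x *\<^sub>R B"])
    show "(\<lambda>x. w' x e) \<in> borel_measurable lborel"
      using cont by (simp add: borel_measurable_continuous_onI)
    show "g n \<in> borel_measurable lborel" for n
      unfolding g_def using int_w int_sh[of "h n *\<^sub>R e"] by (intro borel_measurable_divide borel_measurable_diff) auto
    show "integrable lborel (\<lambda>x::'a. indicator (cball 0 (R + norm e)) x *\<^sub>R B)"
      by (rule borel_integrable_compact) auto
    show "AE x in lborel. (\<lambda>n. g n x) \<longlonglongrightarrow> w' x e"
    proof (intro AE_I2)
      fix x
      have d: "((\<lambda>t. w (t *\<^sub>R e + x)) has_real_derivative w' x e) (at 0)"
      proof -
        have "((\<lambda>t. w (t *\<^sub>R e + x)) has_derivative (\<lambda>t. w' x (t *\<^sub>R e))) (at 0)"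
          by (rule has_derivative_compose[where g=w and f="\<lambda>t. t *\<^sub>R e + x" , simplified])
            (auto intro!: derivative_eq_intros w)
        moreover have "w' x (t *\<^sub>R e) = w' x e * t" for t
          using w[of x] by (simp add: has_derivative_bounded_linear bounded_linear.linear linear_scale mult.commute)
        ultimately show ?thesis by (simp add: has_field_derivative_def)
      qed
      have "((\<lambda>t. (w (t *\<^sub>R e + x) - w x) / t) \<longlongrightarrow> w' x e) (at 0)"
        using d by (simp add: has_field_derivative_iff)
      moreover have "filterlim h (at 0) sequentially"
        using h0 h(1) by (auto simp: filterlim_at less_imp_neq[symmetric])
      ultimately show "(\<lambda>n. g n x) \<longlonglongrightarrow> w' x e" unfolding g_def by (rule filterlim_compose)
    qed
    show "AE x in lborel. norm (g n x) \<le> indicator (cball 0 (R + norm e)) x *\<^sub>R B" for n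
    proof (intro AE_I2)
      fix x
      show "norm (g n x) \<le> indicator (cball 0 (R + norm e)) x *\<^sub>R B"
      proof (cases "norm x \<le> R + norm e")
        case False
        have "norm (h n *\<^sub>R e) \<le> norm e" using h[of n] by (simp add: mult_left_le_one_le)
        then have "R < norm (h n *\<^sub>R e + x)" using False norm_triangle_ineq4[of "h n *\<^sub>R e + x" "h n *\<^sub>R e"] by simp
        moreover have "R < norm x" using False norm_ge_zero[of e] by linarith
        ultimately show ?thesis using supp False by (simp add: g_def)
      next
        case True
        \<comment> \<open>By the mean value theorem a difference quotient is a value of
          \<open>w' _ e\<close>, hence bounded by \<open>B\<close>.\<close>
        have "((\<lambda>t. w (t *\<^sub>R e + x)) has_real_derivative w' (s *\<^sub>R e + x) e) (at s)" for s
        proof -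
          have "((\<lambda>t. w (t *\<^sub>R e + x)) has_derivative (\<lambda>t. w' (s *\<^sub>R e + x) (t *\<^sub>R e))) (at s)"
            by (rule has_derivative_compose[where g=w and f="\<lambda>t. t *\<^sub>R e + x" , simplified])
              (auto intro!: derivative_eq_intros w)
          moreover have "w' (s *\<^sub>R e + x) (t *\<^sub>R e) = w' (s *\<^sub>R e + x) e * t" for t
            using w[of "s *\<^sub>R e + x"] by (simp add: has_derivative_bounded_linear bounded_linear.linear linear_scale mult.commute)
          ultimately show ?thesis by (simp add: has_field_derivative_def)
        qed
        from MVT2[OF h(1)[of n] this] obtain z
          where "w (h n *\<^sub>R e + x) - w (0 *\<^sub>R e + x) = (h n - 0) * w' (z *\<^sub>R e + x) e" by blast
        then have "g n x = w' (z *\<^sub>R e + x) e" using h[of n] by (simp add: g_def)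
        then show ?thesis using True B by simp
      qed
    qed
  qed
  then show ?thesis by (simp add: int_g LIMSEQ_const_iff)
qed

section \<open>Gradients, the divergence theorem and Green's identity\<close>

lemma GDERIV_partial_deriv:
  fixes u :: "real ^ 'n::finite \<Rightarrow> real"
  assumes "GDERIV u x :> D"
  shows "partial_deriv i u x = D $ i" "grad u x = D"
proof -
  have "frechet_derivative u (at x) = (\<lambda>h. h \<bullet> D)"
    using assms by (metis frechet_derivative_at gderiv_def)
  then have "partial_deriv j u x = D $ j" for j
    by (simp add: partial_deriv_def inner_axis' )
  then show "partial_deriv i u x = D $ i" "grad u x = D" by (auto simp: grad_def vec_eq_iff)
qed

text \<open>Expanding a direction in the standard basis turns the coordinatewise \<open>grad\<close>
  into a gradient for the inner product, the form in which product and chain rules are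
  applied.\<close>

lemma C1_GDERIV:
  assumes "C1 u"
  shows "GDERIV u x :> grad u x"
proof -
  have d: "(u has_derivative frechet_derivative u (at x)) (at x)"
    using assms by (simp add: C1_def frechet_derivative_works)
  have "frechet_derivative u (at x) = (\<lambda>h. h \<bullet> grad u x)"
  proof
    fix h
    have lin: "linear (frechet_derivative u (at x))" using d has_derivative_linear by blast
    have "frechet_derivative u (at x) h = frechet_derivative u (at x) (\<Sum>i\<in>UNIV. (h $ i) *\<^sub>R axis i 1)"
      by (simp add: basis_expansion flip: scalar_mult_eq_scaleR)
    also have "\<dots> = (\<Sum>i\<in>UNIV. h $ i * frechet_derivative u (at x) (axis i 1))"
      using lin by (simp add: linear_sum linear_scale)
    also have "\<dots> = h \<bullet> grad u x" by (simp add: inner_vec_def grad_def partial_deriv_def)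
    finally show "frechet_derivative u (at x) h = h \<bullet> grad u x" .
  qed
  then show ?thesis using d by (simp add: gderiv_def)
qed

lemma C1_continuous_grad: "C1 u \<Longrightarrow> continuous_on UNIV (grad u)"
  unfolding grad_def C1_def by (auto intro: continuous_on_vec_lambda)

lemma C1_I:
  fixes u :: "real ^ 'n::finite \<Rightarrow> real"
  assumes d: "\<And>x. GDERIV u x :> D x" and c: "continuous_on UNIV D"
  shows "C1 u"
proof -
  have "partial_deriv i u = (\<lambda>x. D x $ i)" for i
    using GDERIV_partial_deriv[OF d] by auto
  then show ?thesis using d c
    by (auto simp: C1_def gderiv_def differentiable_def intro!: continuous_intros)
qed

lemma C1_continuous: "C1 u \<Longrightarrow> continuous_on UNIV u"
  unfolding C1_def by (meson continuous_at_imp_continuous_on differentiable_imp_continuous_within)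

text \<open>\<open>D i x $ i\<close> is the derivative of the i-th component along the i-th axis, so
  already each summand has integral 0.\<close>

lemma divergence_theorem_bounded_support:
  fixes w :: "'n::finite \<Rightarrow> real ^ 'n \<Rightarrow> real"
  assumes d: "\<And>i x. GDERIV (w i) x :> D i x" and c: "\<And>i. continuous_on UNIV (D i)"
    and supp: "\<And>i x. R < norm x \<Longrightarrow> w i x = 0"
  shows "(LINT x|lborel. (\<Sum>i\<in>UNIV. D i x $ i)) = 0"
proof -
  have eq: "D i x $ i = axis i 1 \<bullet> D i x" for i x by (simp add: inner_axis')
  have ci: "continuous_on UNIV (\<lambda>x. axis i 1 \<bullet> D i x)" for i by (intro continuous_intros c)
  have i0: "(LINT x|lborel. axis i 1 \<bullet> D i x) = 0" for i
    by (rule integral_directional_derivative_eq_0[where w="w i" and R=R])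
      (use d ci supp in \<open>auto simp: gderiv_def\<close>)
  have "integrable lborel (\<lambda>x. axis i 1 \<bullet> D i x)" for i
  proof (rule integrable_continuous_bounded_support[OF ci, of R])
    fix x :: "real ^ 'n" assume x: "R < norm x"
    have "open {y::real^'n. R < norm y}" by (intro open_Collect_less continuous_intros)
    then have "GDERIV (w i) x :> 0" unfolding gderiv_def
      using x supp by (simp, intro has_derivative_transform_within_open[OF has_derivative_const[of 0]]) auto
    then have "D i x = 0" using GDERIV_partial_deriv(2) d by metis
    then show "axis i 1 \<bullet> D i x = 0" by simp
  qed
  then show ?thesis by (simp add: eq Bochner_Integration.integral_sum i0)
qed

lemma C2_C1: "C2 u \<Longrightarrow> C1 u" "C2 u \<Longrightarrow> C1 (partial_deriv i u)"
  by (auto simp: C2_def)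

lemma grad_nth: "grad u x $ i = partial_deriv i u x"
  by (simp add: grad_def)

lemma C2_continuous_laplacian: "C2 u \<Longrightarrow> continuous_on UNIV (laplacian u)"
  unfolding laplacian_def C2_def C1_def by (intro continuous_intros) auto

lemma grad_eq_0_outside:
  fixes E :: "real ^ 'n::finite \<Rightarrow> real"
  assumes "\<And>x. R < norm x \<Longrightarrow> E x = 0" "R < norm x"
  shows "grad E x = 0"
proof -
  have "open {y::real^'n. R < norm y}" by (intro open_Collect_less continuous_intros)
  then have "GDERIV E x :> 0" unfolding gderiv_def
    using assms by (simp, intro has_derivative_transform_within_open[OF has_derivative_const[of 0]]) auto
  then show ?thesis by (rule GDERIV_partial_deriv)
qed

text \<open>Divergence theorem for the field \<open>a(u) E grad u + b(u) grad E\<close>. The first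
  part tests the equation with \<open>a(u) E\<close>. The second is a free correction: through
  \<open>b'\<close> it changes the coefficient of the mixed term, at the price of a term with the
  Laplacian of \<open>E\<close>.\<close>

lemma green_identity:
  fixes u E :: "real ^ 'n::finite \<Rightarrow> real"
  assumes u: "C2 u" and E: "C2 E" and supp: "\<And>x. R < norm x \<Longrightarrow> E x = 0"
    and a: "\<And>s. (a has_real_derivative a' s) (at s)" "continuous_on UNIV a'"
    and b: "\<And>s. (b has_real_derivative b' s) (at s)" "continuous_on UNIV b'"
  shows "(LINT x|lborel. a' (u x) * E x * (norm (grad u x))\<^sup>2 + (a (u x) + b' (u x)) * (grad u x \<bullet> grad E x)
            + a (u x) * E x * laplacian u x + b (u x) * laplacian E x) = 0"
proof -
  define w where "w i x = (a (u x) * E x) * partial_deriv i u x + b (u x) * partial_deriv i E x" for i x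
  define D where "D i x = ((a (u x) * E x) *\<^sub>R grad (partial_deriv i u) x
      + partial_deriv i u x *\<^sub>R (a (u x) *\<^sub>R grad E x + E x *\<^sub>R (a' (u x) *\<^sub>R grad u x)))
      + (b (u x) *\<^sub>R grad (partial_deriv i E) x + partial_deriv i E x *\<^sub>R (b' (u x) *\<^sub>R grad u x))" for i x
  note C1s = C2_C1[OF u] C2_C1[OF E]
  have dw: "GDERIV (w i) x :> D i x" for i x
    unfolding w_def D_def
    by (intro GDERIV_add GDERIV_mult GDERIV_DERIV_compose C1_GDERIV a(1) b(1) C1s)
  have ca: "continuous_on UNIV a" "continuous_on UNIV b"
    by (rule DERIV_continuous_on[OF has_field_derivative_at_within[OF a(1)]]
        DERIV_continuous_on[OF has_field_derivative_at_within[OF b(1)]])+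
  have comp: "continuous_on UNIV (\<lambda>x. g (u x))" if "continuous_on UNIV g" for g :: "real \<Rightarrow> real"
    using continuous_on_compose2[OF that C1_continuous[OF C1s(1)]] by simp
  have cD: "continuous_on UNIV (D i)" for i
    unfolding D_def
    by (intro continuous_intros comp ca a(2) b(2) C1_continuous_grad C1_continuous C1s)
  have sw: "w i x = 0" if "R < norm x" for i x
    using supp[OF that] grad_eq_0_outside[OF supp that, simplified] grad_nth[of E x i]
    by (simp add: w_def)
  have "(LINT x|lborel. (\<Sum>i\<in>UNIV. D i x $ i)) = 0"
    using dw cD sw by (rule divergence_theorem_bounded_support)
  moreover have "(\<Sum>i\<in>UNIV. D i x $ i) =
      a' (u x) * E x * (norm (grad u x))\<^sup>2 + (a (u x) + b' (u x)) * (grad u x \<bullet> grad E x)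
            + a (u x) * E x * laplacian u x + b (u x) * laplacian E x" for x
  proof -
    have "(\<Sum>i\<in>UNIV. D i x $ i) = (\<Sum>i\<in>UNIV. (a (u x) * E x) * partial_deriv i (partial_deriv i u) x
       + a (u x) * (grad u x $ i * grad E x $ i) + a' (u x) * E x * (grad u x $ i * grad u x $ i)
       + b (u x) * partial_deriv i (partial_deriv i E) x + b' (u x) * (grad u x $ i * grad E x $ i))"
      unfolding D_def by (intro sum.cong) (auto simp: algebra_simps grad_nth)
    also have "\<dots> = (a (u x) * E x) * laplacian u x
       + a (u x) * (grad u x \<bullet> grad E x) + a' (u x) * E x * (grad u x \<bullet> grad u x)
       + b (u x) * laplacian E x + b' (u x) * (grad u x \<bullet> grad E x)"
      by (simp add: sum.distrib laplacian_def inner_vec_def flip: sum_distrib_left)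
    finally show ?thesis by (simp add: algebra_simps power2_norm_eq_inner)
  qed
  ultimately show ?thesis by simp
qed

section \<open>Radial cutoff functions and bounds on their derivatives\<close>

definition cutoff :: "real \<Rightarrow> nat \<Rightarrow> 'a::real_inner \<Rightarrow> real" where
  "cutoff R m x = (max 0 (1 - (x \<bullet> x) / R\<^sup>2)) ^ m"

lemma cutoff_nonneg [simp]: "0 \<le> cutoff R m x"
  by (simp add: cutoff_def)

lemma cutoff_le_1 [simp]: "cutoff R m x \<le> 1"
  unfolding cutoff_def by (intro power_le_one) (auto simp: divide_nonneg_nonneg)

text \<open>The cutoff is an explicit power because powers multiply exactly: the square of a cutoff
  is again one, and each derivative merely lowers the exponent by one, a loss compensated later by a
  large exponent.\<close>

lemma cutoff_add: "cutoff R (m + n) x = cutoff R m x * cutoff R n x"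
  by (simp add: cutoff_def power_add)

lemma cutoff_mult2: "cutoff R (2 * m) x = (cutoff R m x)\<^sup>2"
  by (simp add: mult_2 cutoff_add power2_eq_square)

lemma cutoff_eq_0:
  assumes "R > 0" "R \<le> norm x" "m > 0"
  shows "cutoff R m x = 0"
proof -
  have "R\<^sup>2 \<le> x \<bullet> x" using assms by (simp flip: power2_norm_eq_inner)
  then show ?thesis using assms by (simp add: cutoff_def field_simps)
qed

lemma continuous_on_cutoff [continuous_intros]: "continuous_on S (cutoff R m)"
  unfolding cutoff_def[abs_def] by (cases "R = 0") (auto intro!: continuous_intros)

text \<open>An exponent of at least 2 removes the kink at 0, where the difference quotient is at
  most \<open>\<bar>h\<bar> ^ (m - 1)\<close>.\<close>

lemma DERIV_pos_part_power:
  fixes t :: real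
  assumes "m \<ge> 2"
  shows "((\<lambda>t. (max 0 t) ^ m) has_real_derivative real m * (max 0 t) ^ (m - 1)) (at t)"
proof -
  consider "t > 0" | "t < 0" | "t = 0" by linarith
  then show ?thesis
  proof cases
    case 1
    have "((\<lambda>t. t ^ m) has_real_derivative real m * (max 0 t) ^ (m - 1)) (at t)"
      using 1 DERIV_pow[of m t] by (simp add: max_def)
    then show ?thesis
      by (rule has_field_derivative_transform_within_open[where S="{0<..}"]) (use 1 in auto)
  next
    case 2
    have "((\<lambda>t::real. 0) has_real_derivative real m * (max 0 t) ^ (m - 1)) (at t)"
      using 2 assms by (simp add: max_def power_0_left)
    then show ?thesis
      by (rule has_field_derivative_transform_within_open[where S="{..<0}"]) (use 2 assms in auto)
  next
    case 3
    have "((\<lambda>h::real. (max 0 h) ^ m / h) \<longlongrightarrow> 0) (at 0)"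
    proof (rule tendsto_rabs_zero_cancel, rule tendsto_sandwich[OF _ _ tendsto_const])
      show "\<forall>\<^sub>F h::real in at 0. \<bar>(max 0 h) ^ m / h\<bar> \<le> \<bar>h\<bar> ^ (m - 1)"
      proof (intro always_eventually allI)
        fix h :: real
        show "\<bar>(max 0 h) ^ m / h\<bar> \<le> \<bar>h\<bar> ^ (m - 1)"
          using assms power_diff[of h 1 m] by (cases "h > 0") (auto simp: max_def power_0_left)
      qed
      show "((\<lambda>h::real. \<bar>h\<bar> ^ (m - 1)) \<longlongrightarrow> 0) (at 0)"
        using assms by (intro tendsto_null_power tendsto_rabs_zero tendsto_ident_at) simp
    qed auto
    then show ?thesis using 3 assms by (simp add: power_0_left has_field_derivative_iff)
  qed
qed

lemma GDERIV_cutoff: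
  assumes "m \<ge> 2"
  shows "GDERIV (cutoff R m) x :> (- (2 * real m / R\<^sup>2) * cutoff R (m - 1) x) *\<^sub>R x"
proof -
  have "GDERIV (\<lambda>x. 1 - (x \<bullet> x) / R\<^sup>2) x :> (- 2 / R\<^sup>2) *\<^sub>R x"
  proof -
    have "((\<lambda>x. 1 - (x \<bullet> x) * inverse (R\<^sup>2)) has_derivative (\<lambda>h. - ((x \<bullet> h + h \<bullet> x) * inverse (R\<^sup>2)))) (at x)"
      by (auto intro!: derivative_eq_intros)
    then show ?thesis by (simp add: gderiv_def divide_inverse inner_commute algebra_simps)
  qed
  from GDERIV_DERIV_compose[OF this DERIV_pos_part_power[OF assms]]
  show ?thesis by (simp add: cutoff_def[abs_def] algebra_simps)
qed

lemma C1_cutoff: "m \<ge> 2 \<Longrightarrow> C1 (cutoff R m)"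
  by (rule C1_I[OF GDERIV_cutoff]) (simp, intro continuous_intros)

lemma grad_cutoff: "m \<ge> 2 \<Longrightarrow> grad (cutoff R m) x = (- (2 * real m / R\<^sup>2) * cutoff R (m - 1) x) *\<^sub>R x"
  by (rule GDERIV_partial_deriv[OF GDERIV_cutoff])

lemma partial_deriv_cutoff:
  "m \<ge> 2 \<Longrightarrow> partial_deriv i (cutoff R m) x = - (2 * real m / R\<^sup>2) * (cutoff R (m - 1) x * x $ i)"
  using grad_cutoff[of m R x] by (simp flip: grad_nth)

lemma GDERIV_partial_deriv_cutoff:
  fixes x :: "real ^ 'n::finite"
  assumes "m \<ge> 3"
  shows "GDERIV (partial_deriv i (cutoff R m)) x :>
     (- (2 * real m / R\<^sup>2)) *\<^sub>R (cutoff R (m - 1) x *\<^sub>R axis i 1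
        + x $ i *\<^sub>R ((- (2 * real (m - 1) / R\<^sup>2) * cutoff R (m - 2) x) *\<^sub>R x))"
proof -
  have 1: "GDERIV (\<lambda>x::real^'n. x $ i) x :> axis i 1"
    unfolding gderiv_def by (simp add: inner_axis bounded_linear_imp_has_derivative[OF bounded_linear_vec_nth])
  have 2: "GDERIV (cutoff R (m - 1)) x :> (- (2 * real (m - 1) / R\<^sup>2) * cutoff R (m - 2) x) *\<^sub>R x"
    using GDERIV_cutoff[of "m - 1" R x] assms by (simp add: numeral_eq_Suc)
  have "partial_deriv i (cutoff R m) = (\<lambda>x. - (2 * real m / R\<^sup>2) * (cutoff R (m - 1) x * x $ i))"
    using assms by (auto simp: partial_deriv_cutoff)
  moreover have "GDERIV (\<lambda>x. - (2 * real m / R\<^sup>2) * (cutoff R (m - 1) x * x $ i)) x :>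
     (- (2 * real m / R\<^sup>2)) *\<^sub>R (cutoff R (m - 1) x *\<^sub>R axis i 1
        + x $ i *\<^sub>R ((- (2 * real (m - 1) / R\<^sup>2) * cutoff R (m - 2) x) *\<^sub>R x))"
    using GDERIV_mult[OF GDERIV_const[of "- (2 * real m / R\<^sup>2)"] GDERIV_mult[OF 2 1]] by simp
  ultimately show ?thesis by simp
qed

lemma C2_cutoff:
  assumes "m \<ge> 3"
  shows "C2 (cutoff R m :: real ^ 'n::finite \<Rightarrow> real)"
proof -
  have "C1 (partial_deriv i (cutoff R m :: real ^ 'n \<Rightarrow> real))" for i :: 'n
    by (rule C1_I[OF GDERIV_partial_deriv_cutoff[OF assms]]) (intro continuous_intros)
  then show ?thesis using C1_cutoff[of m R] assms by (simp add: C2_def)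
qed

lemma laplacian_cutoff:
  fixes x :: "real ^ 'n::finite"
  assumes "m \<ge> 3"
  shows "laplacian (cutoff R m) x = - (2 * real m / R\<^sup>2) *
     (real CARD('n) * cutoff R (m - 1) x - 2 * real (m - 1) / R\<^sup>2 * cutoff R (m - 2) x * (norm x)\<^sup>2)"
proof -
  have "partial_deriv i (partial_deriv i (cutoff R m)) x = - (2 * real m / R\<^sup>2) *
     (cutoff R (m - 1) x - 2 * real (m - 1) / R\<^sup>2 * cutoff R (m - 2) x * (x $ i * x $ i))" for i
    by (simp add: GDERIV_partial_deriv(1)[OF GDERIV_partial_deriv_cutoff[OF assms]])
  then show ?thesis
    unfolding laplacian_def power2_norm_eq_inner inner_vec_def
    by (simp only: sum_subtractf sum_distrib_left[symmetric] sum_constant inner_real_def)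
qed

text \<open>On the ball \<open>(norm x)^2 / R^2\<close> is at most 1; outside everything
  vanishes.\<close>

lemma norm_grad_cutoff_le:
  fixes x :: "real ^ 'n::finite"
  assumes "R > 0" "m \<ge> 2"
  shows "(norm (grad (cutoff R m) x))\<^sup>2 \<le> 4 * (real m)\<^sup>2 / R\<^sup>2 * cutoff R (2 * m - 2) x"
proof (cases "norm x \<le> R")
  case True
  have "(norm (grad (cutoff R m) x))\<^sup>2 = 4 * (real m)\<^sup>2 / R\<^sup>2 * ((norm x)\<^sup>2 / R\<^sup>2) * (cutoff R (m - 1) x)\<^sup>2"
    using assms by (simp add: grad_cutoff power_mult_distrib power_divide)
  also have "(cutoff R (m - 1) x)\<^sup>2 = cutoff R (2 * m - 2) x"
    by (simp flip: cutoff_mult2 add: diff_mult_distrib2)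
  also have "4 * (real m)\<^sup>2 / R\<^sup>2 * ((norm x)\<^sup>2 / R\<^sup>2) * cutoff R (2 * m - 2) x \<le>
     4 * (real m)\<^sup>2 / R\<^sup>2 * 1 * cutoff R (2 * m - 2) x"
    using True assms by (intro mult_right_mono mult_left_mono) (auto simp: field_simps power_mono)
  finally show ?thesis by simp
next
  case False
  then show ?thesis using assms by (simp add: grad_cutoff cutoff_eq_0)
qed

text \<open>With \<open>2 * k\<close> for \<open>m\<close> the remaining exponent is
  \<open>2 * k - 2\<close>, the same as in the gradient bound with \<open>k\<close> for
  \<open>m\<close>, so one integral controls both error terms.\<close>

lemma laplacian_cutoff_le:
  fixes x :: "real ^ 'n::finite"
  assumes "R > 0" "m \<ge> 3"
  shows "\<bar>laplacian (cutoff R m) x\<bar> \<le> (2 * real m * real CARD('n) + 4 * (real m)\<^sup>2) / R\<^sup>2 * cutoff R (m - 2) x"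
proof (cases "norm x \<le> R")
  case True
  have 1: "cutoff R (m - 1) x \<le> cutoff R (m - 2) x"
    using cutoff_add[of R "m - 2" 1 x] assms
    by (simp add: Suc_diff_le numeral_2_eq_2 Suc_diff_Suc mult_left_le)
  have "\<bar>laplacian (cutoff R m) x\<bar> \<le> 2 * real m / R\<^sup>2 * (real CARD('n) * cutoff R (m - 1) x)
      + 2 * real m / R\<^sup>2 * (2 * real (m - 1) * ((norm x)\<^sup>2 / R\<^sup>2) * cutoff R (m - 2) x)"
    unfolding laplacian_cutoff[OF assms(2)] right_diff_distrib
    by (rule order_trans[OF abs_triangle_ineq4]) (auto simp: abs_mult mult_ac)
  also have "\<dots> \<le> 2 * real m / R\<^sup>2 * (real CARD('n) * cutoff R (m - 2) x)
      + 2 * real m / R\<^sup>2 * (2 * real m * 1 * cutoff R (m - 2) x)"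
    using True assms 1 by (intro add_mono mult_left_mono mult_right_mono mult_mono) (auto simp: field_simps power_mono)
  finally show ?thesis by (simp add: algebra_simps power2_eq_square add_divide_distrib)
next
  case False
  then show ?thesis using assms by (simp add: laplacian_cutoff cutoff_eq_0)
qed

section \<open>Vanishing from cutoff estimates\<close>

text \<open>A case distinction replaces Young's inequality. If \<open>\<kappa> * t\<close> is at
  most \<open>A * p^2 / 2\<close>, it is absorbed. Otherwise the lower bound on \<open>A\<close>
  makes \<open>t powr d\<close> at most a multiple of \<open>p powr -2\<close>, and \<open>k\<close>
  is large enough to compensate this negative power of \<open>p\<close>.\<close>

lemma young_absorb:
  fixes t A \<kappa> c d p :: real
  assumes "0 \<le> t" "0 \<le> A" "0 < \<kappa>" "0 < c" "0 < d" "0 \<le> p" "p \<le> 1"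
    and A: "c * t powr (1 + d) \<le> A" and k: "1 / d + 2 \<le> real k"
  shows "\<kappa> * t * p ^ (2 * k - 2) \<le> A * p ^ (2 * k) / 2 + \<kappa> * (2 * \<kappa> / c) powr (1 / d)"
proof (cases "\<kappa> * t \<le> A * p\<^sup>2 / 2")
  case True
  have k2: "k \<ge> 2" 
  proof -
    have "1 / d > 0" using \<open>d > 0\<close> by simp
    then show ?thesis using k by linarith
  qed
  have "\<kappa> * t * p ^ (2 * k - 2) \<le> A * p\<^sup>2 / 2 * p ^ (2 * k - 2)"
    using True assms by (intro mult_right_mono) auto
  also have "\<dots> = A * p ^ (2 + (2 * k - 2)) / 2" by (simp only: power_add) simp
  also have "2 + (2 * k - 2) = 2 * k" using k2 by simp
  finally show ?thesis using assms by (auto intro!: add_increasing2 mult_nonneg_nonneg)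
next
  case False
  have k2: "k \<ge> 2" 
  proof -
    have "1 / d > 0" using \<open>d > 0\<close> by simp
    then show ?thesis using k by linarith
  qed
  have nn: "0 \<le> A * p ^ (2 * k) / 2" using assms by auto
  show ?thesis
  proof (cases "p = 0")
    case True
    then show ?thesis using assms nn k2 by (simp add: power_0_left)
  next
    case pn: False
    then have p: "p > 0" using assms by auto
    have t: "t > 0" using False assms mult_nonneg_nonneg[of A "p\<^sup>2"] by (cases "t = 0") auto
    have "c * (t * t powr d) * p\<^sup>2 \<le> A * p\<^sup>2"
      using A t by (intro mult_right_mono) (auto simp: powr_add)
    also have "\<dots> < 2 * \<kappa> * t" using False by simp
    finally have "t * (c * p\<^sup>2 * t powr d) < t * (2 * \<kappa>)" by (simp add: mult_ac)
    then have "c * p\<^sup>2 * t powr d < 2 * \<kappa>" using t by simp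
    then have "t powr d \<le> 2 * \<kappa> / c * p powr (- 2)"
      using assms p by (simp add: field_simps powr_minus)
    then have "(t powr d) powr (1 / d) \<le> (2 * \<kappa> / c * p powr (- 2)) powr (1 / d)"
      using assms by (intro powr_mono2) auto
    also have "(2 * \<kappa> / c * p powr (- 2)) powr (1 / d) = (2 * \<kappa> / c) powr (1 / d) * p powr (- 2 / d)"
      using assms p by (subst powr_mult) (auto simp: powr_powr)
    also have "(t powr d) powr (1 / d) = t" using assms t by (simp add: powr_powr)
    finally have "t \<le> (2 * \<kappa> / c) powr (1 / d) * p powr (- 2 / d)" .
    then have "\<kappa> * t * p ^ (2 * k - 2) \<le> \<kappa> * ((2 * \<kappa> / c) powr (1 / d) * p powr (- 2 / d)) * p ^ (2 * k - 2)"
      using assms by (intro mult_right_mono mult_left_mono) auto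
    also have "\<dots> = \<kappa> * (2 * \<kappa> / c) powr (1 / d) * p powr (real (2 * k - 2) - 2 / d)"
      using p by (simp add: powr_realpow[symmetric] powr_diff powr_minus powr_add field_simps)
    also have "\<dots> \<le> \<kappa> * (2 * \<kappa> / c) powr (1 / d) * 1"
      using assms p k k2 by (intro mult_left_mono powr_le1) (auto simp: of_nat_diff)
    finally show ?thesis using nn by simp
  qed
qed

text \<open>Absorbing \<open>K / R^2 * X\<close> pointwise into \<open>A\<close> leaves constants of
  order \<open>R powr (- 2 - 2 / d)\<close> on a ball whose volume grows like \<open>R\<close> to
  the dimension. The dimension condition makes the product tend to 0, whereas
  \<open>A x\<^sub>0 > 0\<close> would keep the left side away from 0. Two exponents occur because
  the lower bound on \<open>A\<close> may differ for small and large values of the solution.\<close>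

lemma vanishing_of_cutoff_estimate:
  fixes A X :: "real ^ 'n::finite \<Rightarrow> real"
  assumes contA: "continuous_on UNIV A" and contX: "continuous_on UNIV X"
    and A0: "\<And>x. 0 \<le> A x" and X0: "\<And>x. 0 \<le> X x"
    and pos: "0 < c" "0 < d1" "0 < d2"
    and dim: "real CARD('n) < 2 * (1 + 1 / d1)" "real CARD('n) < 2 * (1 + 1 / d2)"
    and lower: "\<And>x. c * X x powr (1 + d1) \<le> A x \<or> c * X x powr (1 + d2) \<le> A x"
    and est: "\<And>k. k \<ge> 3 \<Longrightarrow> \<exists>K. \<forall>R\<ge>1. (LINT x|lborel. A x * cutoff R (2 * k) x)
                 \<le> K / R\<^sup>2 * (LINT x|lborel. X x * cutoff R (2 * k - 2) x)"
  shows "A x\<^sub>0 = 0"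
proof (rule ccontr)
  assume "A x\<^sub>0 \<noteq> 0"
  then have Apos: "A x\<^sub>0 > 0" using A0[of x\<^sub>0] by simp
  define k where "k = nat \<lceil>3 + 1 / d1 + 1 / d2\<rceil>"
  have k: "3 + 1 / d1 + 1 / d2 \<le> real k" unfolding k_def by linarith
  have kd: "1 / d1 + 2 \<le> real k" "1 / d2 + 2 \<le> real k" "k \<ge> 3"
  proof -
    have "1 / d1 > 0" "1 / d2 > 0" using pos by auto
    then show "1 / d1 + 2 \<le> real k" "1 / d2 + 2 \<le> real k" "k \<ge> 3" using k by linarith+
  qed
  obtain K0 where K0: "\<And>R. R \<ge> 1 \<Longrightarrow> (LINT x|lborel. A x * cutoff R (2 * k) x)
                 \<le> K0 / R\<^sup>2 * (LINT x|lborel. X x * cutoff R (2 * k - 2) x)"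
    using est[OF kd(3)] by blast
  \<comment> \<open>The constant of the estimate has no known sign, while the absorption needs
    \<open>\<kappa> > 0\<close>.\<close>
  define K where "K = max K0 1"
  have K: "K > 0" by (simp add: K_def)
  define g where "g d = K * (2 * K / c) powr (1 / d) * unit_ball_vol (real CARD('n))" for d
  have int: "integrable lborel (\<lambda>x. B x * cutoff R m x)"
    if "continuous_on UNIV B" "R \<ge> 1" "m > 0" for B :: "real ^ 'n \<Rightarrow> real" and R m
    using that by (intro integrable_continuous_bounded_support[where R=R] continuous_intros)
      (auto intro: cutoff_eq_0)
  have upper: "(LINT x|lborel. A x * cutoff R (2 * k) x) \<le>
      2 * (g d1 * R powr (real CARD('n) - 2 * (1 + 1 / d1)) + g d2 * R powr (real CARD('n) - 2 * (1 + 1 / d2)))"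
    if R: "R \<ge> 1" for R
  proof -
    define \<kappa> where "\<kappa> = K / R\<^sup>2"
    have \<kappa>: "\<kappa> > 0" using K R by (simp add: \<kappa>_def)
    define b where "b d = \<kappa> * (2 * \<kappa> / c) powr (1 / d)" for d
    have b0: "b d \<ge> 0" for d using \<kappa> by (simp add: b_def)
    have bg: "b d * (unit_ball_vol (real CARD('n)) * R ^ CARD('n)) = g d * R powr (real CARD('n) - 2 * (1 + 1 / d))"
      if "d > 0" for d
    proof -
      have "(2 * \<kappa> / c) powr (1 / d) = (2 * K / c) powr (1 / d) * (R powr - 2) powr (1 / d)"
        using K R pos by (subst powr_mult[symmetric]) (auto simp: \<kappa>_def powr_minus field_simps)
      moreover have "\<kappa> = K * R powr - 2" using R by (simp add: \<kappa>_def powr_minus field_simps)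
      ultimately have "b d * (unit_ball_vol (real CARD('n)) * R ^ CARD('n))
         = g d * (R powr real CARD('n) * R powr - 2 * R powr (- 2 / d))"
        using R by (simp add: b_def g_def powr_powr powr_realpow)
      also have "R powr real CARD('n) * R powr - 2 * R powr (- 2 / d) = R powr (real CARD('n) - 2 * (1 + 1 / d))"
        by (simp add: algebra_simps flip: powr_add)
      finally show ?thesis .
    qed
    have "K0 / R\<^sup>2 * (LINT x|lborel. X x * cutoff R (2 * k - 2) x) \<le> \<kappa> * (LINT x|lborel. X x * cutoff R (2 * k - 2) x)"
      unfolding \<kappa>_def K_def using X0 by (intro mult_right_mono integral_nonneg_AE) (auto simp: divide_right_mono)
    also have "\<dots> = (LINT x|lborel. \<kappa> * (X x * cutoff R (2 * k - 2) x))" by simp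
    \<comment> \<open>Both constants are added everywhere, since which lower bound on
      \<open>A\<close> holds may depend on the point.\<close>
    also have "\<dots> \<le> (LINT x|lborel. A x * cutoff R (2 * k) x / 2 + indicator (cball 0 R) x *\<^sub>R (b d1 + b d2))"
    proof (rule integral_mono)
      show "integrable lborel (\<lambda>x. \<kappa> * (X x * cutoff R (2 * k - 2) x))"
        using int[OF contX R, of "2 * k - 2"] kd(3) by simp
      show "integrable lborel (\<lambda>x. A x * cutoff R (2 * k) x / 2 + indicator (cball 0 R) x *\<^sub>R (b d1 + b d2))"
        using int[OF contA R, of "2 * k"] kd(3) borel_integrable_compact[of "cball (0 :: real ^ 'n) R" "\<lambda>_. b d1 + b d2"]
        by auto
      fix x :: "real ^ 'n"
      show "\<kappa> * (X x * cutoff R (2 * k - 2) x) \<le> A x * cutoff R (2 * k) x / 2 + indicator (cball 0 R) x *\<^sub>R (b d1 + b d2)"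
      proof (cases "norm x \<le> R")
        case False
        then show ?thesis using R kd(3) by (simp add: cutoff_eq_0)
      next
        case True
        have c1: "cutoff R m x = cutoff R 1 x ^ m" for m by (simp add: cutoff_def)
        have "\<kappa> * X x * cutoff R 1 x ^ (2 * k - 2) \<le> A x * cutoff R 1 x ^ (2 * k) / 2 + (b d1 + b d2)"
          using lower[of x]
        proof
          assume "c * X x powr (1 + d1) \<le> A x"
          from young_absorb[OF X0 A0 \<kappa> pos(1,2) cutoff_nonneg cutoff_le_1 this kd(1), of R 1 x]
          show ?thesis using b0[of d2] by (simp add: b_def)
        next
          assume "c * X x powr (1 + d2) \<le> A x"
          from young_absorb[OF X0 A0 \<kappa> pos(1,3) cutoff_nonneg cutoff_le_1 this kd(2), of R 1 x]
          show ?thesis using b0[of d1] by (simp add: b_def)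
        qed
        then show ?thesis using True by (simp add: mult.assoc c1[of "2 * k"] c1[of "2 * k - 2"])
      qed
    qed
    also have "\<dots> = (LINT x|lborel. A x * cutoff R (2 * k) x) / 2
        + (b d1 + b d2) * (unit_ball_vol (real CARD('n)) * R ^ CARD('n))"
      using int[OF contA R, of "2 * k"] kd(3) borel_integrable_compact[of "cball (0 :: real ^ 'n) R" "\<lambda>_. b d1 + b d2"] R
      by (subst Bochner_Integration.integral_add) (auto simp: content_cball)
    finally show ?thesis using K0[OF R] pos by (simp add: distrib_right bg)
  qed
  have "isCont A x\<^sub>0" using contA by (simp add: continuous_on_eq_continuous_at)
  then obtain r where r: "r > 0" and Ar: "\<And>x. dist x x\<^sub>0 \<le> r \<Longrightarrow> A x\<^sub>0 / 2 \<le> A x"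
  proof -
    have "\<exists>e>0. \<forall>x. dist x x\<^sub>0 < e \<longrightarrow> dist (A x) (A x\<^sub>0) < A x\<^sub>0 / 2"
      using \<open>isCont A x\<^sub>0\<close>[unfolded continuous_at_eps_delta, rule_format, of "A x\<^sub>0 / 2"] Apos by simp
    then obtain e where "e > 0" "\<And>x. dist x x\<^sub>0 < e \<Longrightarrow> dist (A x) (A x\<^sub>0) < A x\<^sub>0 / 2" by blast
    then show ?thesis
    proof (intro that[of "e / 2"])
      fix x assume e: "e > 0" "\<And>x. dist x x\<^sub>0 < e \<Longrightarrow> dist (A x) (A x\<^sub>0) < A x\<^sub>0 / 2" and "dist x x\<^sub>0 \<le> e / 2"
      then have "dist (A x) (A x\<^sub>0) < A x\<^sub>0 / 2" by (intro e(2)) linarith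
      then show "A x\<^sub>0 / 2 \<le> A x" unfolding dist_real_def by linarith
    qed simp
  qed
  \<comment> \<open>On a small ball \<open>A\<close> is at least half its value at the centre, and
    where \<open>norm x \<le> R / 2\<close> the base of the cutoff is at least 3/4. Hence this lower
    bound does not depend on \<open>R\<close>.\<close>
  define m where "m = A x\<^sub>0 / 2 * (3 / 4) ^ (2 * k) * measure lborel (cball x\<^sub>0 r)"
  have m: "m > 0" using Apos r by (simp add: m_def)
  have low: "m \<le> (LINT x|lborel. A x * cutoff R (2 * k) x)" if R: "R \<ge> 2 * (norm x\<^sub>0 + r) + 1" for R
  proof -
    have "0 \<le> 2 * (norm x\<^sub>0 + r)" using r by simp
    then have R1: "R \<ge> 1" using R by linarith
    have "m = (LINT x|lborel. indicator (cball x\<^sub>0 r) x *\<^sub>R (A x\<^sub>0 / 2 * (3 / 4) ^ (2 * k)))"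
      by (simp add: m_def)
    also have "\<dots> \<le> (LINT x|lborel. A x * cutoff R (2 * k) x)"
    proof (rule integral_mono)
      show "integrable lborel (\<lambda>x. indicator (cball x\<^sub>0 r) x *\<^sub>R (A x\<^sub>0 / 2 * (3 / 4) ^ (2 * k)))"
        by (rule borel_integrable_compact) auto
      show "integrable lborel (\<lambda>x. A x * cutoff R (2 * k) x)"
        using int[OF contA R1] kd(3) by simp
      fix x
      show "indicator (cball x\<^sub>0 r) x *\<^sub>R (A x\<^sub>0 / 2 * (3 / 4) ^ (2 * k)) \<le> A x * cutoff R (2 * k) x"
      proof (cases "x \<in> cball x\<^sub>0 r")
        case False
        then show ?thesis using A0 by simp
      next
        case True
        then have "norm x \<le> R / 2"
          using R norm_triangle_ineq2[of x x\<^sub>0] by (simp add: dist_norm norm_minus_commute)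
        then have "(norm x)\<^sup>2 \<le> (R / 2)\<^sup>2" by (intro power_mono) auto
        then have "3 / 4 \<le> 1 - (x \<bullet> x) / R\<^sup>2"
          using R1 by (simp add: field_simps power2_norm_eq_inner power_divide)
        then have "(3 / 4) ^ (2 * k) \<le> cutoff R (2 * k) x"
          unfolding cutoff_def by (intro power_mono max.coboundedI2) auto
        then have "A x\<^sub>0 / 2 * (3 / 4) ^ (2 * k) \<le> A x * cutoff R (2 * k) x"
          using True Ar[of x] Apos A0[of x] by (intro mult_mono) (auto simp: dist_commute)
        then show ?thesis using True by simp
      qed
    qed
    finally show ?thesis .
  qed
  have lim0: "((\<lambda>R. R powr (real CARD('n) - 2 * (1 + 1 / d))) \<longlongrightarrow> 0) at_top"
    if "real CARD('n) < 2 * (1 + 1 / d)" for d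
    using that by (intro tendsto_neg_powr filterlim_ident) auto
  have "((\<lambda>R. 2 * (g d1 * R powr (real CARD('n) - 2 * (1 + 1 / d1)) + g d2 * R powr (real CARD('n) - 2 * (1 + 1 / d2))))
       \<longlongrightarrow> 2 * (g d1 * 0 + g d2 * 0)) at_top"
    by (intro tendsto_intros lim0 dim)
  moreover have "\<forall>\<^sub>F R in at_top. m \<le> 2 * (g d1 * R powr (real CARD('n) - 2 * (1 + 1 / d1)) + g d2 * R powr (real CARD('n) - 2 * (1 + 1 / d2)))"
    using eventually_ge_at_top[of "2 * (norm x\<^sub>0 + r) + 1"] eventually_ge_at_top[of "1::real"]
    by eventually_elim (rule order_trans[OF low upper])
  ultimately have "m \<le> 2 * (g d1 * 0 + g d2 * 0)"
    by (intro tendsto_lowerbound) auto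
  then show False using m by simp
qed

section \<open>Integral estimates from the equation and from stability\<close>

lemma supersolution_cutoff_estimate:
  fixes u :: "real ^ 'n::finite \<Rightarrow> real"
  assumes u: "C2 u" "\<And>x. 0 \<le> u x" and k: "k \<ge> 3" and R: "R \<ge> 1"
  shows "(LINT x|lborel. - laplacian u x * cutoff R (2 * k) x)
    \<le> (4 * real k * real CARD('n) + 16 * (real k)\<^sup>2) / R\<^sup>2 * (LINT x|lborel. u x * cutoff R (2 * k - 2) x)"
proof -
  define K where "K = 4 * real k * real CARD('n) + 16 * (real k)\<^sup>2"
  have E: "C2 (cutoff R (2 * k) :: real ^ 'n \<Rightarrow> real)" using k by (intro C2_cutoff) auto
  have supp: "cutoff R m x = 0" if "R < norm x" "m > 0" for x :: "real ^ 'n" and m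
    using that R by (intro cutoff_eq_0) auto
  \<comment> \<open>The choice \<open>a = 1\<close>, \<open>b s = - s\<close> cancels the mixed
    term, so that both derivatives of \<open>u\<close> fall on the cutoff.\<close>
  have "(LINT x|lborel. 0 * cutoff R (2 * k) x * (norm (grad u x))\<^sup>2
      + (1 + (- 1)) * (grad u x \<bullet> grad (cutoff R (2 * k)) x)
      + 1 * cutoff R (2 * k) x * laplacian u x + (- u x) * laplacian (cutoff R (2 * k)) x) = 0"
    by (rule green_identity[OF u(1) E, where a="\<lambda>_. 1" and b="\<lambda>s. - s" and R=R])
      (use supp k in \<open>auto intro!: derivative_eq_intros\<close>)
  then have *: "(LINT x|lborel. cutoff R (2 * k) x * laplacian u x - u x * laplacian (cutoff R (2 * k)) x) = 0"
    by simp
  have intL: "integrable lborel (\<lambda>x. cutoff R (2 * k) x * laplacian u x)"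
    using supp k by (intro integrable_continuous_bounded_support[where R=R] continuous_intros C2_continuous_laplacian u) auto
  have intU: "integrable lborel (\<lambda>x. u x * cutoff R (2 * k - 2) x)"
    using supp k by (intro integrable_continuous_bounded_support[where R=R] continuous_intros C1_continuous C2_C1 u) auto
  have ge: "- (u x * laplacian (cutoff R (2 * k)) x) \<le> K / R\<^sup>2 * (u x * cutoff R (2 * k - 2) x)" for x
  proof -
    have "- (u x * laplacian (cutoff R (2 * k)) x) \<le> u x * \<bar>laplacian (cutoff R (2 * k)) x\<bar>"
      using u(2)[of x] by (smt (verit) mult_left_mono mult_minus_right)
    also have "\<dots> \<le> u x * (K / R\<^sup>2 * cutoff R (2 * k - 2) x)"
      using laplacian_cutoff_le[of R "2 * k" x] R k u(2)[of x]
      by (intro mult_left_mono) (auto simp: K_def power_mult_distrib)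
    finally show ?thesis by (simp add: mult_ac)
  qed
  have intE: "integrable lborel (\<lambda>x. u x * laplacian (cutoff R (2 * k)) x)"
  proof (rule integrable_continuous_bounded_support[where R=R])
    show "continuous_on UNIV (\<lambda>x. u x * laplacian (cutoff R (2 * k)) x)"
      by (intro continuous_intros C2_continuous_laplacian C1_continuous C2_C1 u E)
    show "u x * laplacian (cutoff R (2 * k)) x = 0" if "R < norm x" for x
      using that supp k by (simp add: laplacian_cutoff)
  qed
  have "(LINT x|lborel. - laplacian u x * cutoff R (2 * k) x) = (LINT x|lborel. - (cutoff R (2 * k) x * laplacian u x))"
    by (simp add: mult.commute)
  also have "\<dots> = (LINT x|lborel. - (u x * laplacian (cutoff R (2 * k)) x))"
    using * intL intE by (subst (asm) Bochner_Integration.integral_diff) auto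
  also have "\<dots> \<le> (LINT x|lborel. K / R\<^sup>2 * (u x * cutoff R (2 * k - 2) x))"
    using intU intE ge by (intro integral_mono) auto
  finally show ?thesis by (simp add: K_def)
qed

lemma C1_compact_support_cutoff_mult:
  fixes v :: "real ^ 'n::finite \<Rightarrow> real"
  assumes v: "C1 v" and k: "k \<ge> 2" and R: "R > 0"
  shows "C1_compact_support (\<lambda>x. v x * cutoff R k x)"
    and "grad (\<lambda>x. v x * cutoff R k x) x = v x *\<^sub>R grad (cutoff R k) x + cutoff R k x *\<^sub>R grad v x"
proof -
  note P = C1_cutoff[OF k]
  have d: "GDERIV (\<lambda>x. v x * cutoff R k x) x :> v x *\<^sub>R grad (cutoff R k) x + cutoff R k x *\<^sub>R grad v x" for x
    by (intro GDERIV_mult C1_GDERIV v P)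
  then show "grad (\<lambda>x. v x * cutoff R k x) x = v x *\<^sub>R grad (cutoff R k) x + cutoff R k x *\<^sub>R grad v x"
    by (rule GDERIV_partial_deriv)
  have "C1 (\<lambda>x. v x * cutoff R k x)"
    by (rule C1_I[OF d]) (intro continuous_intros C1_continuous_grad C1_continuous v P)
  moreover have "bounded {x :: real ^ 'n. v x * cutoff R k x \<noteq> 0}"
  proof (rule bounded_subset[OF bounded_cball[of 0 R]])
    show "{x :: real ^ 'n. v x * cutoff R k x \<noteq> 0} \<subseteq> cball 0 R"
      using cutoff_eq_0[of R _ k] R k by (force simp: not_le)
  qed
  ultimately show "C1_compact_support (\<lambda>x. v x * cutoff R k x)"
    by (auto simp: C1_compact_support_def)
qed

lemma grad_cutoff_mult2:
  assumes "k \<ge> 2"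
  shows "grad (cutoff R (2 * k)) x = (2 * cutoff R k x) *\<^sub>R grad (cutoff R k) x"
proof -
  have "cutoff R (2 * k - 1) x = cutoff R k x * cutoff R (k - 1) x"
    using assms by (simp add: mult_2 flip: cutoff_add)
  then show ?thesis using assms by (simp add: grad_cutoff)
qed

lemma norm_scaleR_add_squared:
  fixes v w :: "'a::real_inner"
  shows "(norm (a *\<^sub>R v + b *\<^sub>R w))\<^sup>2 = a\<^sup>2 * (norm v)\<^sup>2 + 2 * a * b * (w \<bullet> v) + b\<^sup>2 * (norm w)\<^sup>2"
  unfolding power2_norm_eq_inner
  by (simp add: inner_add_left inner_add_right inner_commute[of v w] power2_eq_square algebra_simps)

text \<open>From the gradient term of the stability inequality for
  \<open>\<psi>(u) * cutoff R k\<close> a function \<open>J\<close> of integral 0 is subtracted.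
  There \<open>G' = \<psi>'^2\<close> removes the term with the squared gradient of
  \<open>u\<close>, and \<open>b = \<psi>^2 / 2 - \<Xi>\<close> removes the mixed term. What remains
  is \<open>f G\<close>, at most \<open>1 - \<epsilon>\<close> times the left integrand, and
  derivatives of the cutoff weighted by \<open>\<psi>^2\<close>.\<close>

lemma stability_cutoff_estimate:
  fixes u :: "real ^ 'n::finite \<Rightarrow> real"
  assumes u: "\<And>x. 0 \<le> u x" and sol: "solution f u" and stable: "is_stable f u"
    and psi: "\<And>s. (\<psi> has_real_derivative \<psi>' s) (at s)" and psi_c: "continuous_on UNIV \<psi>'"
    and G: "\<And>s. (G has_real_derivative (\<psi>' s)\<^sup>2) (at s)"
    and Xi: "\<And>s. (\<Xi> has_real_derivative G s) (at s)"
    and F: "\<And>s. 0 \<le> s \<Longrightarrow> F s = nonlin_deriv f s * (\<psi> s)\<^sup>2" and F_c: "continuous_on UNIV F"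
    and eps: "0 < \<epsilon>" and FG: "\<And>s. 0 \<le> s \<Longrightarrow> f s * G s \<le> (1 - \<epsilon>) * F s"
    and Xi_b: "\<And>s. 0 \<le> s \<Longrightarrow> \<bar>(\<psi> s)\<^sup>2 / 2 - \<Xi> s\<bar> \<le> (\<psi> s)\<^sup>2 / 2"
    and k: "k \<ge> 3" and R: "R \<ge> 1"
  shows "(LINT x|lborel. F (u x) * cutoff R (2 * k) x)
    \<le> (12 * (real k)\<^sup>2 + 2 * real k * real CARD('n)) / \<epsilon> / R\<^sup>2 * (LINT x|lborel. (\<psi> (u x))\<^sup>2 * cutoff R (2 * k - 2) x)"
proof -
  have C2u: "C2 u" and eq: "laplacian u x = - f (u x)" for x
    using sol by (auto simp: solution_def) (metis minus_minus)
  have C1u: "C1 u" using C2u by (rule C2_C1)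
  have k2: "k \<ge> 2" using k by simp
  define E :: "real ^ 'n \<Rightarrow> real" where "E = cutoff R (2 * k)"
  define P :: "real ^ 'n \<Rightarrow> real" where "P = cutoff R k"
  define Q :: "real ^ 'n \<Rightarrow> real" where "Q = cutoff R (2 * k - 2)"
  define \<phi> where "\<phi> x = \<psi> (u x) * P x" for x
  \<comment> \<open>The gradient of \<open>P\<close> contributes \<open>4 * k^2\<close>; half the
    Laplacian bound for exponent \<open>2 * k\<close> contributes the rest.\<close>
  define K where "K = 12 * (real k)\<^sup>2 + 2 * real k * real CARD('n)"
  have C2E: "C2 E" unfolding E_def using k by (intro C2_cutoff) auto
  have supp: "cutoff R m x = 0" if "R < norm x" "m > 0" for x :: "real ^ 'n" and m
    using that R by (intro cutoff_eq_0) auto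
  have gpsi: "GDERIV (\<lambda>x. \<psi> (u x)) x :> \<psi>' (u x) *\<^sub>R grad u x" for x
    by (intro GDERIV_DERIV_compose C1_GDERIV C1u psi)
  have comp: "continuous_on UNIV (\<lambda>x. g (u x))" if "continuous_on UNIV g" for g :: "real \<Rightarrow> real"
    using continuous_on_compose2[OF that C1_continuous[OF C1u]] by simp
  have cont: "continuous_on UNIV \<psi>" "continuous_on UNIV G" "continuous_on UNIV \<Xi>"
    by (rule DERIV_continuous_on[OF has_field_derivative_at_within[OF psi]]
        DERIV_continuous_on[OF has_field_derivative_at_within[OF G]]
        DERIV_continuous_on[OF has_field_derivative_at_within[OF Xi]])+
  have C1psi: "C1 (\<lambda>x. \<psi> (u x))"
    by (rule C1_I[OF gpsi]) (intro continuous_intros comp psi_c C1_continuous_grad C1u)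
  have gradpsi: "grad (\<lambda>x. \<psi> (u x)) x = \<psi>' (u x) *\<^sub>R grad u x" for x
    using gpsi by (rule GDERIV_partial_deriv)
  have phi: "C1_compact_support \<phi>"
    and grad_phi: "grad \<phi> x = \<psi> (u x) *\<^sub>R grad P x + P x *\<^sub>R (\<psi>' (u x) *\<^sub>R grad u x)" for x
    using C1_compact_support_cutoff_mult[OF C1psi k2, of R] R
    by (simp_all add: \<phi>_def[abs_def] P_def gradpsi)
  define J where "J x = \<psi>' (u x) ^ 2 * E x * (norm (grad u x))\<^sup>2
      + (G (u x) + (\<psi> (u x) * \<psi>' (u x) - G (u x))) * (grad u x \<bullet> grad E x)
      + G (u x) * E x * laplacian u x + ((\<psi> (u x))\<^sup>2 / 2 - \<Xi> (u x)) * laplacian E x" for x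
  have J0: "(LINT x|lborel. J x) = 0"
    unfolding J_def
  proof (rule green_identity[OF C2u C2E, where a=G and b="\<lambda>s. (\<psi> s)\<^sup>2 / 2 - \<Xi> s" and R=R
        and a'="\<lambda>s. \<psi>' s ^ 2" and b'="\<lambda>s. \<psi> s * \<psi>' s - G s"])
    show "E x = 0" if "R < norm x" for x using that k supp by (simp add: E_def)
    show "((\<lambda>s. (\<psi> s)\<^sup>2 / 2 - \<Xi> s) has_real_derivative \<psi> s * \<psi>' s - G s) (at s)" for s
      by (auto intro!: derivative_eq_intros psi Xi)
  qed (intro G continuous_intros psi_c cont)+
  have phiJ: "(norm (grad \<phi> x))\<^sup>2 - J x = (\<psi> (u x))\<^sup>2 * (norm (grad P x))\<^sup>2 + f (u x) * G (u x) * E x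
      - ((\<psi> (u x))\<^sup>2 / 2 - \<Xi> (u x)) * laplacian E x" for x
  proof -
    have gE: "grad E x = (2 * P x) *\<^sub>R grad P x"
      using grad_cutoff_mult2[OF k2] by (simp add: E_def P_def)
    have EP: "E x = P x * P x" by (simp add: E_def P_def cutoff_mult2 power2_eq_square)
    have N: "(norm (grad \<phi> x))\<^sup>2 = (\<psi> (u x))\<^sup>2 * (norm (grad P x))\<^sup>2
        + 2 * \<psi> (u x) * P x * \<psi>' (u x) * (grad u x \<bullet> grad P x) + (P x * \<psi>' (u x))\<^sup>2 * (norm (grad u x))\<^sup>2"
      unfolding grad_phi scaleR_scaleR by (simp add: norm_scaleR_add_squared)
    have *: "a\<^sup>2 * n + 2 * a * p * b * g + (p * b)\<^sup>2 * m - (b\<^sup>2 * (p * p) * m + (h + (a * b - h)) * (2 * p * g)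
       + h * (p * p) * - c + d * l) = a\<^sup>2 * n + c * h * (p * p) - d * l"
      for a b c d g h l m n p :: real
      by (simp add: power2_eq_square algebra_simps)
    show ?thesis
      unfolding N J_def eq gE EP inner_scaleR_right by (rule *)
  qed
  have int: "integrable lborel (\<lambda>x. B x * cutoff R m x)"
    if "continuous_on UNIV B" "m > 0" for B :: "real ^ 'n \<Rightarrow> real" and m
    using that R supp by (intro integrable_continuous_bounded_support[where R=R] continuous_intros)
      auto
  have cJ: "continuous_on UNIV J"
    unfolding J_def
    by (intro continuous_intros comp[OF psi_c] comp[OF cont(1)] comp[OF cont(2)] comp[OF cont(3)]
        C1_continuous_grad[OF C1u] C1_continuous_grad[OF C2_C1(1)[OF C2E]] C1_continuous[OF C2_C1(1)[OF C2E]]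
        C2_continuous_laplacian[OF C2u] C2_continuous_laplacian[OF C2E]) auto
  have outside: "E x = 0" "grad E x = 0" "laplacian E x = 0" "grad P x = 0" "P x = 0" if "R < norm x" for x
    using that supp k by (simp_all add: E_def P_def grad_cutoff laplacian_cutoff)
  have intJ: "integrable lborel J"
    using cJ by (rule integrable_continuous_bounded_support[where R=R]) (simp add: J_def outside)
  have "C1 \<phi>" using phi by (simp add: C1_compact_support_def)
  then have intphi: "integrable lborel (\<lambda>x. (norm (grad \<phi> x))\<^sup>2)"
    by (intro integrable_continuous_bounded_support[where R=R] continuous_intros C1_continuous_grad)
      (simp_all add: grad_phi outside)
  have intF: "integrable lborel (\<lambda>x. F (u x) * E x)"
    unfolding E_def using k by (intro int comp F_c) auto
  have intQ: "integrable lborel (\<lambda>x. (\<psi> (u x))\<^sup>2 * Q x)"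
    unfolding Q_def using k by (intro int comp continuous_intros cont) auto
  have "(LINT x|lborel. F (u x) * E x) = (LINT x|lborel. nonlin_deriv f (u x) * (\<phi> x)\<^sup>2)"
    using F[OF u] by (simp add: \<phi>_def E_def P_def cutoff_mult2 power_mult_distrib mult.assoc)
  also have "\<dots> \<le> (LINT x|lborel. (norm (grad \<phi> x))\<^sup>2)"
    using stable phi by (simp add: is_stable_def)
  also have "\<dots> = (LINT x|lborel. (norm (grad \<phi> x))\<^sup>2 - J x)"
    using J0 intJ intphi by simp
  also have "\<dots> \<le> (LINT x|lborel. K / R\<^sup>2 * ((\<psi> (u x))\<^sup>2 * Q x) + (1 - \<epsilon>) * (F (u x) * E x))"
  proof (rule integral_mono)
    show "integrable lborel (\<lambda>x. (norm (grad \<phi> x))\<^sup>2 - J x)" using intJ intphi by simp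
    show "integrable lborel (\<lambda>x. K / R\<^sup>2 * ((\<psi> (u x))\<^sup>2 * Q x) + (1 - \<epsilon>) * (F (u x) * E x))"
      using intF intQ by simp
    fix x
    have 1: "(\<psi> (u x))\<^sup>2 * (norm (grad P x))\<^sup>2 \<le> (\<psi> (u x))\<^sup>2 * (4 * (real k)\<^sup>2 / R\<^sup>2 * Q x)"
      unfolding P_def Q_def using R k by (intro mult_left_mono norm_grad_cutoff_le) auto
    have 2: "f (u x) * G (u x) * E x \<le> (1 - \<epsilon>) * F (u x) * E x"
      using FG[OF u] by (intro mult_right_mono) (auto simp: E_def)
    have "- (((\<psi> (u x))\<^sup>2 / 2 - \<Xi> (u x)) * laplacian E x) \<le> \<bar>(\<psi> (u x))\<^sup>2 / 2 - \<Xi> (u x)\<bar> * \<bar>laplacian E x\<bar>"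
      by (simp flip: abs_mult)
    also have "\<dots> \<le> (\<psi> (u x))\<^sup>2 / 2 * ((2 * real (2 * k) * real CARD('n) + 4 * (real (2 * k))\<^sup>2) / R\<^sup>2 * Q x)"
      unfolding E_def Q_def using R k by (intro mult_mono Xi_b u laplacian_cutoff_le) auto
    finally have 3: "- (((\<psi> (u x))\<^sup>2 / 2 - \<Xi> (u x)) * laplacian E x)
       \<le> (\<psi> (u x))\<^sup>2 * ((8 * (real k)\<^sup>2 + 2 * real k * real CARD('n)) / R\<^sup>2 * Q x)"
      by (simp add: power2_eq_square algebra_simps add_divide_distrib)
    have "(\<psi> (u x))\<^sup>2 * (4 * (real k)\<^sup>2 / R\<^sup>2 * Q x)
       + (\<psi> (u x))\<^sup>2 * ((8 * (real k)\<^sup>2 + 2 * real k * real CARD('n)) / R\<^sup>2 * Q x) = K / R\<^sup>2 * ((\<psi> (u x))\<^sup>2 * Q x)"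
      by (simp add: K_def algebra_simps add_divide_distrib)
    with 1 2 3 show "(norm (grad \<phi> x))\<^sup>2 - J x \<le> K / R\<^sup>2 * ((\<psi> (u x))\<^sup>2 * Q x) + (1 - \<epsilon>) * (F (u x) * E x)"
      unfolding phiJ by (simp add: mult.assoc)
  qed
  also have "\<dots> = K / R\<^sup>2 * (LINT x|lborel. (\<psi> (u x))\<^sup>2 * Q x) + (1 - \<epsilon>) * (LINT x|lborel. F (u x) * E x)"
    using intF intQ by simp
  finally have "\<epsilon> * (LINT x|lborel. F (u x) * E x) \<le> K / R\<^sup>2 * (LINT x|lborel. (\<psi> (u x))\<^sup>2 * Q x)"
    by (simp add: algebra_simps)
  then have "(LINT x|lborel. F (u x) * E x) \<le> K / R\<^sup>2 * (LINT x|lborel. (\<psi> (u x))\<^sup>2 * Q x) / \<epsilon>"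
    unfolding pos_le_divide_eq[OF eps] by (subst mult.commute)
  then show ?thesis by (simp add: K_def E_def Q_def mult.commute[of \<epsilon>])
qed

section \<open>The interpolated test function\<close>

text \<open>Since \<open>\<beta>^2 = (2 * \<beta> - 1) + (\<beta> - 1)^2\<close> and
  \<open>(\<beta> - 1)^2 \<le> (\<alpha> - 1)^2 < r\<close>, there is an additive gap
  \<open>r - (\<alpha> - 1)^2\<close>. Dividing it by \<open>2 * \<alpha> + r\<close>, which bounds
  \<open>2 * \<beta> - 1 + r\<close>, turns it into a factor independent of \<open>\<beta>\<close>.
  It is used with \<open>y = f'^2\<close> and \<open>z = f * f''\<close>.\<close>

lemma ramp_weight_bound:
  fixes \<alpha> \<beta> r y z :: real
  assumes "1 \<le> \<beta>" "\<beta> \<le> \<alpha>" "(\<alpha> - 1)\<^sup>2 < r" "0 \<le> y" "r * y \<le> z"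
  shows "\<beta>\<^sup>2 * y \<le> (1 - (r - (\<alpha> - 1)\<^sup>2) / (2 * \<alpha> + r)) * ((2 * \<beta> - 1) * y + z)"
proof -
  define d where "d = r - (\<alpha> - 1)\<^sup>2"
  define M where "M = 2 * \<alpha> + r"
  have r: "r > 0" using assms(3) by (smt (verit) zero_le_power2)
  have M: "M > 0" "d \<le> M" "d > 0" using assms r zero_le_power2[of "\<alpha> - 1"] unfolding M_def d_def by linarith+
  have "(\<beta> - 1)\<^sup>2 \<le> (\<alpha> - 1)\<^sup>2" using assms by (intro power_mono) auto
  then have "\<beta>\<^sup>2 \<le> (2 * \<beta> - 1 + r) - d" by (simp add: d_def power2_eq_square algebra_simps)
  also have "\<dots> \<le> (2 * \<beta> - 1 + r) - d * ((2 * \<beta> - 1 + r) / M)"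
  proof -
    have "(2 * \<beta> - 1 + r) / M \<le> 1" using M assms by (simp add: M_def)
    then show ?thesis using M mult_left_le[of "(2 * \<beta> - 1 + r) / M" d] by simp
  qed
  also have "\<dots> = (1 - d / M) * (2 * \<beta> - 1 + r)" by (simp only: left_diff_distrib) simp
  finally have "\<beta>\<^sup>2 * y \<le> (1 - d / M) * (2 * \<beta> - 1 + r) * y" using assms by (intro mult_right_mono)
  also have "\<dots> = (1 - d / M) * ((2 * \<beta> - 1) * y + r * y)" by (simp add: algebra_simps)
  also have "\<dots> \<le> (1 - d / M) * ((2 * \<beta> - 1) * y + z)"
    using assms M by (intro mult_left_mono) auto
  finally show ?thesis by (simp add: d_def M_def)
qed

lemma continuous_antiderivative:
  fixes g :: "real \<Rightarrow> real"
  assumes "continuous_on UNIV g"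
  obtains h where "\<And>s. (h has_real_derivative g s) (at s)" "h 0 = 0"
proof -
  obtain F where F: "\<And>x. (F has_vector_derivative g x) (at x)"
    using einterval_antiderivative[of "-\<infinity>" \<infinity> g] assms
    by (auto simp: continuous_on_eq_continuous_at)
  show ?thesis
  proof (rule that[of "\<lambda>s. F s - F 0"])
    show "((\<lambda>s. F s - F 0) has_real_derivative g s) (at s)" for s
      using F[of s] by (auto intro!: derivative_eq_intros simp: has_real_derivative_iff_has_vector_derivative[symmetric])
  qed simp
qed

section \<open>Consequences of convexity and of one-sided bounds on \<open>q\<close>\<close>

locale nonlinearity =
  fixes f f' f'' :: "real \<Rightarrow> real"
  assumes cont: "continuous_on {0..} f"
    and deriv1: "\<And>s. 0 < s \<Longrightarrow> (f has_real_derivative f' s) (at s)"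
    and deriv2: "\<And>s. 0 < s \<Longrightarrow> (f' has_real_derivative f'' s) (at s)"
    and pos: "\<And>s. 0 < s \<Longrightarrow> 0 < f s"
    and deriv1_nonneg: "\<And>s. 0 < s \<Longrightarrow> 0 \<le> f' s"
    and deriv2_nonneg: "\<And>s. 0 < s \<Longrightarrow> 0 \<le> f'' s"
begin

lemma deriv_mono: "0 < s \<Longrightarrow> s \<le> t \<Longrightarrow> f' s \<le> f' t"
  by (rule deriv_nonneg_imp_mono[of s t f' f'']) (auto intro!: deriv2 deriv2_nonneg)

lemma mono_pos: "0 < s \<Longrightarrow> s \<le> t \<Longrightarrow> f s \<le> f t"
  by (rule deriv_nonneg_imp_mono[of s t f f']) (auto intro!: deriv1 deriv1_nonneg)

text \<open>Convexity at the endpoint 0, where \<open>f\<close> is only continuous: the mean value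
  theorem gives a slope at an inner point, which is at most \<open>f' s\<close>.\<close>

lemma tangent_0:
  assumes "0 < s"
  shows "f s - f 0 \<le> s * f' s"
proof -
  have "\<exists>l z. 0 < z \<and> z < s \<and> (f has_real_derivative l) (at z) \<and> f s - f 0 = (s - 0) * l"
    using assms deriv1 by (intro MVT continuous_on_subset[OF cont])
      (auto simp: real_differentiable_def)
  then obtain l z where z: "0 < z" "z < s" "(f has_real_derivative l) (at z)" "f s - f 0 = s * l" by auto
  then have "l = f' z" using deriv1 DERIV_unique by blast
  then show ?thesis using z deriv_mono[of z s] assms by simp
qed

lemma deriv_pos:
  assumes "f 0 = 0" "0 < s"
  shows "0 < f' s"
  using tangent_0[OF assms(2)] pos[OF assms(2)] assms by (smt (verit) zero_less_mult_pos)

lemma tendsto_0: "(f \<longlongrightarrow> f 0) (at_right 0)"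
  using cont by (auto simp: continuous_on_def at_within_Ici_at_right dest!: bspec[of _ _ 0])

text \<open>The sign of \<open>f * f'' - r * f'^2\<close>, for positive \<open>r\<close> the
  comparison of \<open>q\<close> with \<open>1 / r\<close>, decides whether
  \<open>f' * f powr (- r)\<close> increases or decreases.\<close>

lemma deriv_quotient_powr:
  assumes "0 < s"
  shows "((\<lambda>s. f' s * f s powr (- r)) has_real_derivative
     f s powr (- r - 1) * (f s * f'' s - r * (f' s)\<^sup>2)) (at s)"
proof -
  have "((\<lambda>s. f' s * f s powr (- r)) has_real_derivative
     f'' s * f s powr (- r) + f' s * (- r * f s powr (- r - 1) * f' s)) (at s)"
    using assms pos[OF assms] by (auto intro!: derivative_eq_intros deriv1 deriv2)
  moreover have "f s powr (- r) = f s powr (- r - 1) * f s"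
    using pos[OF assms] by (simp add: powr_diff powr_minus)
  ultimately show ?thesis by (simp add: algebra_simps power2_eq_square)
qed

text \<open>\<open>f' * f powr (- r)\<close> is nondecreasing from \<open>a\<close> on, hence stays
  above its value at \<open>a\<close>.\<close>

lemma deriv_ge_powr_at_top:
  assumes "0 < a" "0 < f' a" and q: "\<And>s. a \<le> s \<Longrightarrow> r * (f' s)\<^sup>2 \<le> f s * f'' s"
  obtains c where "0 < c" "\<And>s. a \<le> s \<Longrightarrow> c * f s powr r \<le> f' s"
proof (rule that[of "f' a * f a powr (- r)"])
  show "0 < f' a * f a powr (- r)" using assms pos[of a] by simp
  fix s assume s: "a \<le> s"
  have "f' a * f a powr (- r) \<le> f' s * f s powr (- r)"
  proof (rule DERIV_nonneg_imp_nondecreasing[OF s])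
    fix x assume "a \<le> x" "x \<le> s"
    then show "\<exists>y. ((\<lambda>s. f' s * f s powr (- r)) has_real_derivative y) (at x) \<and> 0 \<le> y"
      using deriv_quotient_powr[of x r] q[of x] assms
      by (intro exI conjI) (assumption | simp)+
  qed
  then show "f' a * f a powr (- r) * f s powr r \<le> f' s"
    using pos[of s] s assms by (simp add: powr_minus field_simps)
qed

text \<open>To the left of \<open>a\<close> the opposite inequality is the useful one: a
  nonincreasing \<open>f' * f powr (- r)\<close> stays above its value at \<open>a\<close>.\<close>

lemma deriv_ge_powr_at_0:
  assumes "0 < a" "0 < f' a" and q: "\<And>s. 0 < s \<Longrightarrow> s \<le> a \<Longrightarrow> f s * f'' s \<le> r * (f' s)\<^sup>2"
  obtains c where "0 < c" "\<And>s. 0 < s \<Longrightarrow> s \<le> a \<Longrightarrow> c * f s powr r \<le> f' s"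
proof (rule that[of "f' a * f a powr (- r)"])
  show "0 < f' a * f a powr (- r)" using assms pos[of a] by simp
  fix s assume s: "0 < s" "s \<le> a"
  have "f' a * f a powr (- r) \<le> f' s * f s powr (- r)"
  proof (rule DERIV_nonpos_imp_nonincreasing[OF s(2)])
    fix x assume "s \<le> x" "x \<le> a"
    then show "\<exists>y. ((\<lambda>s. f' s * f s powr (- r)) has_real_derivative y) (at x) \<and> y \<le> 0"
      using deriv_quotient_powr[of x r] q[of x] s
      by (intro exI conjI) (assumption | simp add: mult_nonneg_nonpos)+
  qed
  then show "f' a * f a powr (- r) * f s powr r \<le> f' s"
    using pos[of s] s assms by (simp add: powr_minus field_simps)
qed

end

text \<open>\<open>r0\<close> and \<open>r1\<close> bound \<open>1 / q\<close> from below near 0 and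
  near infinity. The conditions \<open>(\<alpha> - 1)^2 < r\<close> are those of
  \<open>ramp_weight_bound\<close>, and \<open>\<alpha>0 > 1\<close> gives the test function slope 0
  at the origin.\<close>

locale interpolated_test_function = nonlinearity +
  fixes a b \<alpha>0 \<alpha>1 r0 r1 :: real
  assumes f0: "f 0 = 0" and ab: "0 < a" "a \<le> b"
    and ratio_near_0: "\<And>s. 0 < s \<Longrightarrow> s \<le> a \<Longrightarrow> r0 * (f' s)\<^sup>2 \<le> f s * f'' s"
    and ratio_at_top: "\<And>s. b \<le> s \<Longrightarrow> r1 * (f' s)\<^sup>2 \<le> f s * f'' s"
    and \<alpha>0: "1 < \<alpha>0" "(\<alpha>0 - 1)\<^sup>2 < r0" and \<alpha>1: "1 \<le> \<alpha>1" "(\<alpha>1 - 1)\<^sup>2 < r1"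
begin

section \<open>The local exponent, the test function and its regularity at 0\<close>

definition ramp :: "real \<Rightarrow> real" where
  "ramp s = max 0 s - max 0 (s - 1)"

text \<open>\<open>ramp\<close> clamps its argument to the unit interval. Writing it with positive
  parts makes this antiderivative a difference of halved squares, differentiable also at the
  corners.\<close>

definition ramp_int :: "real \<Rightarrow> real" where
  "ramp_int s = (max 0 s)\<^sup>2 / 2 - (max 0 (s - 1))\<^sup>2 / 2"

lemma ramp_bounds: "0 \<le> ramp s" "ramp s \<le> 1" "s \<le> 0 \<Longrightarrow> ramp s = 0"
  by (auto simp: ramp_def max_def)

lemma deriv_ramp_int: "(ramp_int has_real_derivative ramp s) (at s)"
proof -
  have *: "((\<lambda>s. (max 0 s)\<^sup>2) has_real_derivative 2 * max 0 s) (at s)" for s :: real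
    using DERIV_pos_part_power[of 2 s] by simp
  have "((\<lambda>s. (max 0 (s - 1))\<^sup>2) has_real_derivative 2 * max 0 (s - 1)) (at s)"
    using DERIV_shift[of "\<lambda>s. (max 0 s)\<^sup>2" "2 * max 0 (s - 1)" s "-1"] *[of "s - 1"] by simp
  from DERIV_diff[OF DERIV_cdivide[OF *[of s], of 2] DERIV_cdivide[OF this, of 2]]
  show ?thesis by (simp add: ramp_int_def[abs_def] ramp_def)
qed

text \<open>\<open>\<beta> (ln (f s))\<close> is the local exponent of the test function as a power of \<open>f\<close>: it is \<open>\<alpha>0\<close> near \<open>0\<close>,
  \<open>1\<close> on \<open>[a, b]\<close> and \<open>\<alpha>1\<close> near infinity. Its antiderivative \<open>\<Lambda>\<close> expresses \<open>ln \<psi>\<close> in terms of \<open>ln f\<close>.\<close>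

definition \<beta> :: "real \<Rightarrow> real" where
  "\<beta> t = 1 + (\<alpha>1 - 1) * ramp (t - ln (f b)) + (\<alpha>0 - 1) * ramp (ln (f a) - t)"

definition \<Lambda> :: "real \<Rightarrow> real" where
  "\<Lambda> t = t + (\<alpha>1 - 1) * ramp_int (t - ln (f b)) - (\<alpha>0 - 1) * ramp_int (ln (f a) - t)"

lemma deriv_\<Lambda>: "(\<Lambda> has_real_derivative \<beta> t) (at t)"
  unfolding \<Lambda>_def[abs_def] \<beta>_def
  by (auto intro!: derivative_eq_intros DERIV_chain'[OF _ deriv_ramp_int])

lemma continuous_\<beta>: "continuous_on UNIV \<beta>"
  unfolding \<beta>_def[abs_def] ramp_def by (intro continuous_intros)

lemma \<beta>_ge_1: "1 \<le> \<beta> t"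
  using \<alpha>0 \<alpha>1 ramp_bounds by (auto simp: \<beta>_def add_increasing2)

lemma ln_mono_pos: "0 < s \<Longrightarrow> s \<le> t \<Longrightarrow> ln (f s) \<le> ln (f t)"
  using pos mono_pos by (simp add: ln_mono)

lemma \<beta>_le_\<alpha>0:
  assumes "0 < s" "s \<le> a"
  shows "\<beta> (ln (f s)) \<le> \<alpha>0"
proof -
  have "(\<alpha>0 - 1) * ramp (ln (f a) - ln (f s)) \<le> \<alpha>0 - 1"
    using \<alpha>0 by (intro mult_left_le ramp_bounds) auto
  moreover have "ramp (ln (f s) - ln (f b)) = 0"
    using ln_mono_pos[of s b] assms ab by (intro ramp_bounds) auto
  ultimately show ?thesis unfolding \<beta>_def by simp
qed

lemma \<beta>_eq_1: "a \<le> s \<Longrightarrow> s \<le> b \<Longrightarrow> \<beta> (ln (f s)) = 1"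
  using ramp_bounds(3)[of "ln (f s) - ln (f b)"] ramp_bounds(3)[of "ln (f a) - ln (f s)"]
    ln_mono_pos[of s b] ln_mono_pos[of a s] ab by (simp add: \<beta>_def)

lemma \<beta>_le_\<alpha>1:
  assumes "b \<le> s"
  shows "\<beta> (ln (f s)) \<le> \<alpha>1"
proof -
  have "(\<alpha>1 - 1) * ramp (ln (f s) - ln (f b)) \<le> \<alpha>1 - 1"
    using \<alpha>1 by (intro mult_left_le ramp_bounds) auto
  moreover have "ramp (ln (f a) - ln (f s)) = 0"
    using ln_mono_pos[of a s] assms ab by (intro ramp_bounds) auto
  ultimately show ?thesis unfolding \<beta>_def by simp
qed

text \<open>One unit below \<open>ln (f a)\<close> the ramp at \<open>ln (f a)\<close> is saturated
  and the other one has not started, so \<open>\<Lambda>\<close> is affine with slope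
  \<open>\<alpha>0\<close>. Hence \<open>\<psi>\<close> is exactly a multiple of
  \<open>f powr \<alpha>0\<close> near 0.\<close>

lemma \<Lambda>_at_bot:
  assumes "t \<le> ln (f a) - 1"
  shows "\<Lambda> t = \<alpha>0 * t + \<Lambda> (ln (f a) - 1) - \<alpha>0 * (ln (f a) - 1)"
proof -
  have *: "ramp_int (t - ln (f b)) = 0" if "t \<le> ln (f a) - 1" for t
    using that ln_mono_pos[of a b] ab by (simp add: ramp_int_def)
  have **: "ramp_int s = s - 1 / 2" if "1 \<le> s" for s
    using that by (simp add: ramp_int_def power2_eq_square field_simps)
  show ?thesis using assms *[OF assms] *[of "ln (f a) - 1"] by (simp add: \<Lambda>_def ** algebra_simps)
qed

lemma \<Lambda>_at_top:
  assumes "ln (f b) + 1 \<le> t"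
  shows "\<Lambda> t = \<alpha>1 * t + \<Lambda> (ln (f b) + 1) - \<alpha>1 * (ln (f b) + 1)"
proof -
  have *: "ramp_int (ln (f a) - t) = 0" if "ln (f b) + 1 \<le> t" for t
    using that ln_mono_pos[of a b] ab by (simp add: ramp_int_def)
  have **: "ramp_int s = s - 1 / 2" if "1 \<le> s" for s
    using that by (simp add: ramp_int_def power2_eq_square field_simps)
  show ?thesis using assms *[OF assms] *[of "ln (f b) + 1"] by (simp add: \<Lambda>_def ** algebra_simps)
qed

lemma \<Lambda>_mono: "s \<le> t \<Longrightarrow> \<Lambda> s \<le> \<Lambda> t"
  by (rule deriv_nonneg_imp_mono[of s t \<Lambda> \<beta>]) (use deriv_\<Lambda> \<beta>_ge_1 in \<open>auto intro: order_trans[OF zero_le_one]\<close>)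

text \<open>Extended by 0 to nonpositive arguments, so that the chain rule applies to
  \<open>\<psi>(u)\<close> on the whole space, also where \<open>u\<close> vanishes.\<close>

definition \<psi> :: "real \<Rightarrow> real" where
  "\<psi> s = (if 0 < s then exp (\<Lambda> (ln (f s))) else 0)"

definition \<psi>' :: "real \<Rightarrow> real" where
  "\<psi>' s = (if 0 < s then \<beta> (ln (f s)) * \<psi> s * f' s / f s else 0)"

lemma \<psi>_at_0:
  obtains C where "0 < C" "\<And>s. 0 < s \<Longrightarrow> ln (f s) \<le> ln (f a) - 1 \<Longrightarrow> \<psi> s = C * f s powr \<alpha>0"
proof (rule that[of "exp (\<Lambda> (ln (f a) - 1) - \<alpha>0 * (ln (f a) - 1))"])
  fix s :: real assume s: "0 < s" "ln (f s) \<le> ln (f a) - 1"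
  then show "\<psi> s = exp (\<Lambda> (ln (f a) - 1) - \<alpha>0 * (ln (f a) - 1)) * f s powr \<alpha>0"
    using pos[of s] by (simp add: \<psi>_def \<Lambda>_at_bot[OF s(2)] powr_def flip: exp_add)
qed simp

lemma \<psi>_at_top:
  obtains C where "0 < C" "\<And>s. 0 < s \<Longrightarrow> ln (f b) + 1 \<le> ln (f s) \<Longrightarrow> \<psi> s = C * f s powr \<alpha>1"
proof (rule that[of "exp (\<Lambda> (ln (f b) + 1) - \<alpha>1 * (ln (f b) + 1))"])
  fix s :: real assume s: "0 < s" "ln (f b) + 1 \<le> ln (f s)"
  then show "\<psi> s = exp (\<Lambda> (ln (f b) + 1) - \<alpha>1 * (ln (f b) + 1)) * f s powr \<alpha>1"
    using pos[of s] by (simp add: \<psi>_def \<Lambda>_at_top[OF s(2)] powr_def flip: exp_add)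
qed simp

lemma \<psi>_pos: "0 < s \<Longrightarrow> 0 < \<psi> s"
  by (simp add: \<psi>_def)

lemma \<psi>_0: "s \<le> 0 \<Longrightarrow> \<psi> s = 0" "s \<le> 0 \<Longrightarrow> \<psi>' s = 0"
  by (simp_all add: \<psi>_def \<psi>'_def)

lemma \<psi>'_nonneg: "0 \<le> \<psi>' s"
  using \<beta>_ge_1[of "ln (f s)"] pos[of s] deriv1_nonneg[of s] by (auto simp: \<psi>'_def \<psi>_def intro!: divide_nonneg_pos mult_nonneg_nonneg)

lemma deriv_\<psi>_pos:
  assumes "0 < s"
  shows "(\<psi> has_real_derivative \<psi>' s) (at s)"
proof -
  have "((\<lambda>s. ln (f s)) has_real_derivative 1 / f s * f' s) (at s)"
    by (rule DERIV_chain2[OF DERIV_ln_divide deriv1]) (use assms pos in auto)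
  then have "((\<lambda>s. \<Lambda> (ln (f s))) has_real_derivative \<beta> (ln (f s)) * (1 / f s * f' s)) (at s)"
    by (rule DERIV_chain2[OF deriv_\<Lambda>])
  then have "((\<lambda>s. exp (\<Lambda> (ln (f s)))) has_real_derivative \<psi>' s) (at s)"
    using DERIV_fun_exp assms by (force simp: \<psi>'_def \<psi>_def mult_ac)
  then show ?thesis
    by (rule has_field_derivative_transform_within_open[where S="{0<..}"]) (use assms in \<open>auto simp: \<psi>_def\<close>)
qed

lemma tendsto_powr_0: "0 < r \<Longrightarrow> ((\<lambda>s. f s powr r) \<longlongrightarrow> 0) (at_right 0)"
proof -
  assume r: "0 < r"
  have "((\<lambda>s. f s powr r) \<longlongrightarrow> 0 powr r) (at_right 0)"
  proof (rule tendsto_powr'[OF _ tendsto_const])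
    show "(f \<longlongrightarrow> 0) (at_right 0)" using tendsto_0 f0 by simp
    show "(0::real) \<noteq> 0 \<or> 0 < r \<and> (\<forall>\<^sub>F x in at_right 0. 0 \<le> f x)"
      using r eventually_mono[OF eventually_at_right_less[of 0], of "\<lambda>x. 0 \<le> f x"] pos by (simp add: less_imp_le)
  qed
  then show ?thesis using r by simp
qed

lemma eventually_at_0: "\<forall>\<^sub>F s in at_right 0. 0 < s \<and> s \<le> a \<and> ln (f s) \<le> ln (f a) - 1"
proof -
  have "\<forall>\<^sub>F s in at_right 0. f s < f a * exp (- 1)"
    using tendsto_0 f0 pos[OF ab(1)] by (intro order_tendstoD(2)) auto
  moreover have "\<forall>\<^sub>F s in at_right 0. 0 < s \<and> s < a"
    using ab by (auto simp: eventually_at_right_field)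
  ultimately show ?thesis
  proof eventually_elim
    case (elim s)
    then have "ln (f s) \<le> ln (f a * exp (- 1))" using pos[of s] by (intro ln_mono) auto
    then show ?case using elim pos[OF ab(1)] by (simp add: ln_mult)
  qed
qed

text \<open>Near 0, \<open>\<psi>\<close> is a multiple of
  \<open>f powr (\<alpha>0 - 1) * f\<close>, where \<open>f s \<le> s * f' s\<close> and
  \<open>f' s \<le> f' a\<close>. The factor \<open>f powr (\<alpha>0 - 1)\<close> tends to 0, and
  therefore so do \<open>\<psi> s / s\<close> and \<open>\<psi>' s\<close>.\<close>

lemma \<psi>_bounds_at_0:
  obtains C where "0 < C" "\<forall>\<^sub>F s in at_right 0. \<psi> s \<le> C * f s powr (\<alpha>0 - 1) * s \<and> \<psi>' s \<le> C * f s powr (\<alpha>0 - 1)"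
proof -
  obtain C where C: "0 < C" "\<And>s. 0 < s \<Longrightarrow> ln (f s) \<le> ln (f a) - 1 \<Longrightarrow> \<psi> s = C * f s powr \<alpha>0"
    using \<psi>_at_0 by blast
  have fa: "0 < f' a" using tangent_0[OF ab(1)] pos[OF ab(1)] ab f0 by (smt (verit) zero_less_mult_pos)
  show ?thesis
  proof (rule that[of "C * \<alpha>0 * f' a"])
    show "0 < C * \<alpha>0 * f' a" using C \<alpha>0 fa by simp
    show "\<forall>\<^sub>F s in at_right 0. \<psi> s \<le> C * \<alpha>0 * f' a * f s powr (\<alpha>0 - 1) * s \<and> \<psi>' s \<le> C * \<alpha>0 * f' a * f s powr (\<alpha>0 - 1)"
      using eventually_at_0
    proof eventually_elim
      case (elim s)
      then have s: "0 < s" "s \<le> a" "f s > 0" "f' s \<le> f' a" "0 \<le> f' s" "f s \<le> s * f' s"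
        using pos deriv_mono deriv1_nonneg tangent_0[of s] f0 by auto
      have eq: "\<psi> s = C * f s powr (\<alpha>0 - 1) * f s" using C(2) elim s by (simp add: powr_diff)
      have "f s \<le> \<alpha>0 * f' a * s"
      proof -
        have "f s \<le> 1 * f' s * s" using s by (simp add: mult.commute)
        also have "\<dots> \<le> \<alpha>0 * f' a * s" using s \<alpha>0 by (intro mult_right_mono mult_mono) auto
        finally show ?thesis .
      qed
      then have "\<psi> s \<le> C * f s powr (\<alpha>0 - 1) * (\<alpha>0 * f' a * s)"
        unfolding eq using C by (intro mult_left_mono) auto
      moreover have "\<psi>' s = C * f s powr (\<alpha>0 - 1) * (\<beta> (ln (f s)) * f' s)" using s by (simp add: \<psi>'_def eq)
      moreover have "C * f s powr (\<alpha>0 - 1) * (\<beta> (ln (f s)) * f' s) \<le> C * f s powr (\<alpha>0 - 1) * (\<alpha>0 * f' a)"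
        using s C \<alpha>0 \<beta>_le_\<alpha>0[of s] by (intro mult_left_mono mult_mono) auto
      ultimately show ?case by (simp add: mult_ac)
    qed
  qed
qed

lemma \<psi>'_tendsto_0: "(\<psi>' \<longlongrightarrow> 0) (at_right 0)"
proof -
  obtain C where C: "\<forall>\<^sub>F s in at_right 0. \<psi> s \<le> C * f s powr (\<alpha>0 - 1) * s \<and> \<psi>' s \<le> C * f s powr (\<alpha>0 - 1)"
    using \<psi>_bounds_at_0 by blast
  have "((\<lambda>s. C * f s powr (\<alpha>0 - 1)) \<longlongrightarrow> C * 0) (at_right 0)"
    using \<alpha>0 by (intro tendsto_intros tendsto_powr_0) simp
  then show ?thesis
    by (intro tendsto_sandwich[OF _ _ tendsto_const, of 0 \<psi>'])
      (use C \<psi>'_nonneg in \<open>auto elim: eventually_mono\<close>)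
qed

lemma deriv_\<psi>: "(\<psi> has_real_derivative \<psi>' s) (at s)"
proof -
  consider "s > 0" | "s < 0" | "s = 0" by linarith
  then show ?thesis
  proof cases
    case 1
    then show ?thesis by (rule deriv_\<psi>_pos)
  next
    case 2
    have "((\<lambda>_. 0) has_real_derivative \<psi>' s) (at s)" using 2 by (simp add: \<psi>_0)
    then show ?thesis
      by (rule has_field_derivative_transform_within_open[where S="{..<0}"]) (use 2 in \<open>auto simp: \<psi>_0\<close>)
  next
    case 3
    obtain C where C: "\<forall>\<^sub>F s in at_right 0. \<psi> s \<le> C * f s powr (\<alpha>0 - 1) * s \<and> \<psi>' s \<le> C * f s powr (\<alpha>0 - 1)"
      using \<psi>_bounds_at_0 by blast
    have "((\<lambda>s. C * f s powr (\<alpha>0 - 1)) \<longlongrightarrow> C * 0) (at_right 0)"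
      using \<alpha>0 by (intro tendsto_intros tendsto_powr_0) simp
    moreover have "\<forall>\<^sub>F s in at_right 0. \<psi> s / s \<le> C * f s powr (\<alpha>0 - 1)"
      using C eventually_at_right_less[of 0] by eventually_elim (simp add: field_simps)
    ultimately have R: "((\<lambda>s. \<psi> s / s) \<longlongrightarrow> 0) (at_right 0)"
      by (intro tendsto_sandwich[OF _ _ tendsto_const, of 0 "\<lambda>s. \<psi> s / s"])
        (auto simp: eventually_at_right_field \<psi>_def intro!: exI[of _ 1])
    have "((\<lambda>s. \<psi> s / s) \<longlongrightarrow> 0) (at_left 0)"
      by (rule Lim_transform_eventually[OF tendsto_const])
        (auto simp: eventually_at_left_field \<psi>_0 intro!: exI[of _ "-1"])
    with R have "((\<lambda>s. \<psi> s / s) \<longlongrightarrow> 0) (at 0)" by (simp add: filterlim_at_split)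
    then show ?thesis using 3 by (simp add: has_field_derivative_iff \<psi>_0)
  qed
qed

lemma continuous_extend_by_0:
  fixes g :: "real \<Rightarrow> real"
  assumes "\<And>s. 0 < s \<Longrightarrow> isCont g s" "\<And>s. s \<le> 0 \<Longrightarrow> g s = 0" "(g \<longlongrightarrow> 0) (at_right 0)"
  shows "continuous_on UNIV g"
proof -
  have "isCont g s" for s
  proof -
    consider "s > 0" | "s < 0" | "s = 0" by linarith
    then show ?thesis
    proof cases
      case 2
      have "\<forall>\<^sub>F x in nhds s. x < 0" using 2 eventually_nhds_in_open[of "{..<0}" s] by simp
      then have "\<forall>\<^sub>F x in nhds s. g x = 0" by eventually_elim (simp add: assms)
      then show ?thesis using isCont_cong[of g "\<lambda>_. 0" s] by simp
    next
      case 3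
      have "(g \<longlongrightarrow> 0) (at_left 0)"
        by (rule Lim_transform_eventually[OF tendsto_const])
          (auto simp: eventually_at_left_field assms intro!: exI[of _ "-1"])
      then show ?thesis using 3 assms by (simp add: isCont_def filterlim_at_split)
    qed (rule assms)
  qed
  then show ?thesis by (simp add: continuous_on_eq_continuous_at)
qed

lemma isCont_pos: "0 < s \<Longrightarrow> isCont f s" "0 < s \<Longrightarrow> isCont f' s" "isCont \<psi> s"
  using deriv1 deriv2 deriv_\<psi> DERIV_isCont by blast+

lemma continuous_\<psi>': "continuous_on UNIV \<psi>'"
proof (rule continuous_extend_by_0)
  fix s :: real assume s: "0 < s"
  have c\<beta>: "isCont \<beta> x" for x using continuous_\<beta> by (simp add: continuous_on_eq_continuous_at)
  have "isCont (\<lambda>s. ln (f s)) s" using s pos[OF s] isCont_pos by (intro continuous_intros) auto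
  then have "isCont (\<lambda>s. \<beta> (ln (f s))) s" using c\<beta> by (rule isCont_o2)
  then have c: "isCont (\<lambda>s. \<beta> (ln (f s)) * \<psi> s * f' s / f s) s"
    using s pos[OF s] isCont_pos by (intro continuous_intros) auto
  have "\<forall>\<^sub>F x in nhds s. 0 < x" using s eventually_nhds_in_open[of "{0<..}" s] by simp
  then have "\<forall>\<^sub>F x in nhds s. \<psi>' x = \<beta> (ln (f x)) * \<psi> x * f' x / f x" by eventually_elim (simp add: \<psi>'_def)
  then show "isCont \<psi>' s" using c by (simp add: isCont_cong)
qed (auto simp: \<psi>_0 \<psi>'_tendsto_0)

section \<open>Comparison of \<open>G\<close> with \<open>\<psi>^2 * f' / f\<close>\<close>

definition W :: "real \<Rightarrow> real" where
  "W s = (\<psi> s)\<^sup>2 * f' s / f s"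

text \<open>As \<open>f * W = f' * \<psi>^2\<close>, the inequality aimed at is
  \<open>G \<le> (1 - \<epsilon>) * W\<close>. Both \<open>W'\<close> and
  \<open>G' = \<psi>'^2\<close> carry the factor \<open>\<psi>^2 / f^2\<close>, and
  \<open>ramp_weight_bound\<close> compares what is left.\<close>

lemma deriv_W:
  assumes s: "0 < s"
  shows "(W has_real_derivative (\<psi> s)\<^sup>2 / (f s)\<^sup>2 * ((2 * \<beta> (ln (f s)) - 1) * (f' s)\<^sup>2 + f s * f'' s)) (at s)"
proof -
  have "(W has_real_derivative
     ((2 * \<psi> s * \<psi>' s * f' s + f'' s * (\<psi> s)\<^sup>2) * f s - (\<psi> s)\<^sup>2 * f' s * f' s) / (f s * f s)) (at s)"
    unfolding W_def[abs_def] using s pos[OF s]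
    by (auto intro!: derivative_eq_intros deriv1 deriv2 deriv_\<psi>)
  moreover have "((2 * \<psi> s * \<psi>' s * f' s + f'' s * (\<psi> s)\<^sup>2) * f s - (\<psi> s)\<^sup>2 * f' s * f' s) / (f s * f s)
     = (\<psi> s)\<^sup>2 / (f s)\<^sup>2 * ((2 * \<beta> (ln (f s)) - 1) * (f' s)\<^sup>2 + f s * f'' s)"
    using s pos[OF s] by (simp add: \<psi>'_def field_simps power2_eq_square)
  ultimately show ?thesis by simp
qed

lemma \<psi>'_sq: "0 < s \<Longrightarrow> (\<psi>' s)\<^sup>2 = (\<psi> s)\<^sup>2 / (f s)\<^sup>2 * ((\<beta> (ln (f s)))\<^sup>2 * (f' s)\<^sup>2)"
  by (simp add: \<psi>'_def power_mult_distrib power_divide)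

lemma W_le: "0 < s \<Longrightarrow> W s \<le> \<psi> s * \<psi>' s"
proof -
  assume s: "0 < s"
  have "1 * W s \<le> \<beta> (ln (f s)) * W s"
    using s pos[OF s] deriv1_nonneg[OF s] by (intro mult_right_mono \<beta>_ge_1) (simp add: W_def)
  then show ?thesis using s by (simp add: W_def \<psi>'_def power2_eq_square mult_ac)
qed

lemma W_pos: "0 < s \<Longrightarrow> 0 < W s"
  using \<psi>_pos[of s] pos[of s] deriv_pos[OF f0, of s] by (simp add: W_def)

lemma W_tendsto_0: "(W \<longlongrightarrow> 0) (at_right 0)"
proof -
  have "(\<psi> \<longlongrightarrow> 0) (at_right 0)"
    using isCont_pos(3)[of 0] by (simp add: isCont_def \<psi>_0 filterlim_at_split)
  then have "((\<lambda>s. \<psi> s * \<psi>' s) \<longlongrightarrow> 0 * 0) (at_right 0)"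
    by (intro tendsto_mult \<psi>'_tendsto_0)
  moreover have "\<forall>\<^sub>F s in at_right 0. 0 \<le> W s" "\<forall>\<^sub>F s in at_right 0. W s \<le> \<psi> s * \<psi>' s"
    using eventually_at_right_less[of "0::real"] by (auto elim!: eventually_mono intro: W_le less_imp_le[OF W_pos])
  ultimately show ?thesis by (intro tendsto_sandwich[OF _ _ tendsto_const, of 0 W]) auto
qed

definition \<theta>0 :: real where "\<theta>0 = 1 - (r0 - (\<alpha>0 - 1)\<^sup>2) / (2 * \<alpha>0 + r0)"
definition \<theta>1 :: real where "\<theta>1 = 1 - (r1 - (\<alpha>1 - 1)\<^sup>2) / (2 * \<alpha>1 + r1)"

lemma \<theta>_less_1: "\<theta>0 < 1" "\<theta>1 < 1"
proof -
  have "0 < r0" "0 < r1" using \<alpha>0 \<alpha>1 by (smt (verit) zero_le_power2)+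
  then show "\<theta>0 < 1" "\<theta>1 < 1" using \<alpha>0 \<alpha>1 by (auto simp: \<theta>0_def \<theta>1_def)
qed

lemma \<psi>'_sq_le_deriv_W:
  assumes "0 < s"
  shows "s \<le> a \<Longrightarrow> (\<psi>' s)\<^sup>2 \<le> \<theta>0 * ((\<psi> s)\<^sup>2 / (f s)\<^sup>2 * ((2 * \<beta> (ln (f s)) - 1) * (f' s)\<^sup>2 + f s * f'' s))"
    and "a \<le> s \<Longrightarrow> s \<le> b \<Longrightarrow> (\<psi>' s)\<^sup>2 \<le> (\<psi> s)\<^sup>2 / (f s)\<^sup>2 * ((2 * \<beta> (ln (f s)) - 1) * (f' s)\<^sup>2 + f s * f'' s)"
    and "b \<le> s \<Longrightarrow> (\<psi>' s)\<^sup>2 \<le> \<theta>1 * ((\<psi> s)\<^sup>2 / (f s)\<^sup>2 * ((2 * \<beta> (ln (f s)) - 1) * (f' s)\<^sup>2 + f s * f'' s))"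
proof -
  have *: "(\<psi>' s)\<^sup>2 \<le> t * ((\<psi> s)\<^sup>2 / (f s)\<^sup>2 * ((2 * \<beta> (ln (f s)) - 1) * (f' s)\<^sup>2 + f s * f'' s))"
    if "(\<beta> (ln (f s)))\<^sup>2 * (f' s)\<^sup>2 \<le> t * ((2 * \<beta> (ln (f s)) - 1) * (f' s)\<^sup>2 + f s * f'' s)" for t
    using mult_left_mono[OF that, of "(\<psi> s)\<^sup>2 / (f s)\<^sup>2"] unfolding \<psi>'_sq[OF assms] by (simp add: mult_ac)
  show "s \<le> a \<Longrightarrow> (\<psi>' s)\<^sup>2 \<le> \<theta>0 * ((\<psi> s)\<^sup>2 / (f s)\<^sup>2 * ((2 * \<beta> (ln (f s)) - 1) * (f' s)\<^sup>2 + f s * f'' s))"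
    unfolding \<theta>0_def using assms \<alpha>0 by (intro * ramp_weight_bound \<beta>_ge_1 \<beta>_le_\<alpha>0 ratio_near_0) auto
  show "b \<le> s \<Longrightarrow> (\<psi>' s)\<^sup>2 \<le> \<theta>1 * ((\<psi> s)\<^sup>2 / (f s)\<^sup>2 * ((2 * \<beta> (ln (f s)) - 1) * (f' s)\<^sup>2 + f s * f'' s))"
    unfolding \<theta>1_def using assms \<alpha>1 by (intro * ramp_weight_bound \<beta>_ge_1 \<beta>_le_\<alpha>1 ratio_at_top) auto
  \<comment> \<open>For \<open>\<beta> = 1\<close> the two sides differ by \<open>f * f''\<close> up
    to the common factor. This is known to be nonnegative but gives no factor below 1.\<close>
  show "(\<psi>' s)\<^sup>2 \<le> (\<psi> s)\<^sup>2 / (f s)\<^sup>2 * ((2 * \<beta> (ln (f s)) - 1) * (f' s)\<^sup>2 + f s * f'' s)" if "a \<le> s" "s \<le> b"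
    using *[of 1] assms that pos[OF assms] deriv2_nonneg[OF assms] by (simp add: \<beta>_eq_1)
qed

lemma W_mono: "0 < s \<Longrightarrow> s \<le> t \<Longrightarrow> W s \<le> W t"
proof (rule deriv_nonneg_imp_mono[OF deriv_W])
  fix x assume x: "0 < s" "x \<in> {s..t}"
  then have "0 \<le> (2 * \<beta> (ln (f x)) - 1) * (f' x)\<^sup>2 + f x * f'' x"
    using pos[of x] deriv2_nonneg[of x] \<beta>_ge_1[of "ln (f x)"] by (intro add_nonneg_nonneg mult_nonneg_nonneg) auto
  then show "0 \<le> (\<psi> x)\<^sup>2 / (f x)\<^sup>2 * ((2 * \<beta> (ln (f x)) - 1) * (f' x)\<^sup>2 + f x * f'' x)" by simp
qed auto

lemma deriv_gap_mono:
  assumes G: "\<And>s. (G has_real_derivative (\<psi>' s)\<^sup>2) (at s)" and st: "0 < s" "s \<le> t"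
    and le: "\<And>x. s \<le> x \<Longrightarrow> x \<le> t \<Longrightarrow>
      (\<psi>' x)\<^sup>2 \<le> \<theta> * ((\<psi> x)\<^sup>2 / (f x)\<^sup>2 * ((2 * \<beta> (ln (f x)) - 1) * (f' x)\<^sup>2 + f x * f'' x))"
  shows "\<theta> * W s - G s \<le> \<theta> * W t - G t"
proof (rule deriv_nonneg_imp_mono[OF DERIV_diff[OF DERIV_cmult[OF deriv_W] G]])
  show "0 < x" if "x \<in> {s..t}" for x using st that by simp
  show "0 \<le> \<theta> * ((\<psi> x)\<^sup>2 / (f x)\<^sup>2 * ((2 * \<beta> (ln (f x)) - 1) * (f' x)\<^sup>2 + f x * f'' x)) - (\<psi>' x)\<^sup>2"
    if "x \<in> {s..t}" for x using le[of x] that by simp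
qed (rule st)

text \<open>Near 0, \<open>\<theta>0 * W - G\<close> is nondecreasing and tends to 0 at 0, which
  starts the estimate. On the middle part \<open>W - G\<close> is nondecreasing, so the gap reached
  at \<open>a\<close> persists. Beyond \<open>b\<close> it is propagated by monotonicity of
  \<open>(1 - \<epsilon>) * W - G\<close>.\<close>

lemma G_le_W:
  assumes G: "\<And>s. (G has_real_derivative (\<psi>' s)\<^sup>2) (at s)" and G0: "G 0 = 0"
  obtains \<epsilon> where "0 < \<epsilon>" "\<epsilon> \<le> 1" "\<And>s. 0 < s \<Longrightarrow> G s \<le> (1 - \<epsilon>) * W s"
proof -
  have near: "G s \<le> \<theta>0 * W s" if s: "0 < s" "s \<le> a" for s
  proof -
    have "isCont G 0" using G DERIV_isCont by blast
    then have "(G \<longlongrightarrow> 0) (at_right 0)" using G0 by (simp add: isCont_def filterlim_at_split)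
    then have "((\<lambda>t. \<theta>0 * W t - G t) \<longlongrightarrow> \<theta>0 * 0 - 0) (at_right 0)" by (intro tendsto_intros W_tendsto_0)
    moreover have "\<forall>\<^sub>F t in at_right 0. \<theta>0 * W t - G t \<le> \<theta>0 * W s - G s"
      using eventually_at_right_real[OF s(1)]
    proof eventually_elim
      case (elim t)
      then show ?case using s by (intro deriv_gap_mono[OF G] \<psi>'_sq_le_deriv_W) auto
    qed
    ultimately have "\<theta>0 * 0 - 0 \<le> \<theta>0 * W s - G s" by (rule tendsto_upperbound) simp
    then show ?thesis by simp
  qed
  \<comment> \<open>The absolute gap at \<open>a\<close>. Divided by \<open>W b\<close>, the largest
    value of \<open>W\<close> on the middle part, it becomes a relative one.\<close>
  define d where "d = (1 - \<theta>0) * W a"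
  have d: "0 < d" using \<theta>_less_1 W_pos ab by (simp add: d_def)
  have mid: "G s \<le> W s - d" if "a \<le> s" "s \<le> b" for s
    using deriv_gap_mono[OF G ab(1) that(1), of 1] \<psi>'_sq_le_deriv_W(2) near[of a] ab that
    by (simp add: d_def algebra_simps)
  define \<epsilon> where "\<epsilon> = Min {1 - \<theta>0, d / W b, 1 - \<theta>1, 1}"
  have eps: "0 < \<epsilon>" "\<epsilon> \<le> 1 - \<theta>0" "\<epsilon> \<le> d / W b" "\<epsilon> \<le> 1 - \<theta>1" "\<epsilon> \<le> 1"
    using \<theta>_less_1 d W_pos[of b] ab by (auto simp: \<epsilon>_def)
  have mid': "G s \<le> (1 - \<epsilon>) * W s" if "a \<le> s" "s \<le> b" for s
  proof -
    have "\<epsilon> * W s \<le> d / W b * W b"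
      using eps W_mono[of s b] W_pos[of s] W_pos[of b] ab that by (intro mult_mono) auto
    then show ?thesis using mid[OF that] W_pos[of b] ab by (simp add: algebra_simps)
  qed
  show ?thesis
  proof (rule that[OF eps(1) eps(5)])
    fix s :: real assume s: "0 < s"
    consider "s \<le> a" | "a \<le> s" "s \<le> b" | "b \<le> s" by linarith
    then show "G s \<le> (1 - \<epsilon>) * W s"
    proof cases
      case 1
      then have "G s \<le> \<theta>0 * W s" using near s by blast
      also have "\<dots> \<le> (1 - \<epsilon>) * W s" using eps W_pos[OF s] by (intro mult_right_mono) auto
      finally show ?thesis .
    next
      case 2
      then show ?thesis by (rule mid')
    next
      case 3
      have "(1 - \<epsilon>) * W b - G b \<le> (1 - \<epsilon>) * W s - G s"
      proof (rule deriv_gap_mono[OF G])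
        fix x assume x: "b \<le> x" "x \<le> s"
        have "0 \<le> (2 * \<beta> (ln (f x)) - 1) * (f' x)\<^sup>2 + f x * f'' x"
          using pos[of x] deriv2_nonneg[of x] \<beta>_ge_1[of "ln (f x)"] x ab
          by (intro add_nonneg_nonneg mult_nonneg_nonneg) auto
        then have "\<theta>1 * ((\<psi> x)\<^sup>2 / (f x)\<^sup>2 * ((2 * \<beta> (ln (f x)) - 1) * (f' x)\<^sup>2 + f x * f'' x))
           \<le> (1 - \<epsilon>) * ((\<psi> x)\<^sup>2 / (f x)\<^sup>2 * ((2 * \<beta> (ln (f x)) - 1) * (f' x)\<^sup>2 + f x * f'' x))"
          using eps by (intro mult_right_mono) auto
        then show "(\<psi>' x)\<^sup>2 \<le> (1 - \<epsilon>) * ((\<psi> x)\<^sup>2 / (f x)\<^sup>2 * ((2 * \<beta> (ln (f x)) - 1) * (f' x)\<^sup>2 + f x * f'' x))"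
          using \<psi>'_sq_le_deriv_W(3)[of x] x ab by linarith
      qed (use 3 ab in auto)
      then show ?thesis using mid'[of b] ab by simp
    qed
  qed
qed

text \<open>The value 0 at 0 agrees with \<open>nonlin_deriv f 0 * (\<psi> 0)^2\<close> because
  \<open>\<psi> 0 = 0\<close>.\<close>

definition \<Psi> :: "real \<Rightarrow> real" where
  "\<Psi> s = (if 0 < s then f' s * (\<psi> s)\<^sup>2 else 0)"

lemma continuous_\<Psi>: "continuous_on UNIV \<Psi>"
proof (rule continuous_extend_by_0)
  fix s :: real assume s: "0 < s"
  have c: "isCont (\<lambda>s. f' s * (\<psi> s)\<^sup>2) s"
    using s isCont_pos by (intro continuous_intros) auto
  have "\<forall>\<^sub>F x in nhds s. 0 < x" using s eventually_nhds_in_open[of "{0<..}" s] by simp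
  then have "\<forall>\<^sub>F x in nhds s. \<Psi> x = f' x * (\<psi> x)\<^sup>2" by eventually_elim (simp add: \<Psi>_def)
  then show "isCont \<Psi> s" using c by (simp add: isCont_cong)
next
  \<comment> \<open>Writing \<open>\<Psi> = W * f\<close> gives the limit at 0 without a limit of
    \<open>f'\<close>.\<close>
  have "((\<lambda>s. W s * f s) \<longlongrightarrow> 0 * f 0) (at_right 0)"
    by (intro tendsto_mult W_tendsto_0 tendsto_0)
  moreover have "\<forall>\<^sub>F s in at_right 0. W s * f s = \<Psi> s"
    using eventually_at_right_less[of "0::real"] by eventually_elim (use pos in \<open>auto simp: W_def \<Psi>_def less_imp_neq[symmetric]\<close>)
  ultimately show "(\<Psi> \<longlongrightarrow> 0) (at_right 0)" by (simp add: Lim_transform_eventually)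
qed (simp add: \<Psi>_def)

text \<open>With \<open>G\<close> and \<open>\<Xi>\<close> vanishing at 0, integrating
  \<open>0 \<le> G \<le> 2 * \<psi> * \<psi>' = (\<psi>^2)'\<close> gives
  \<open>0 \<le> \<Xi> \<le> \<psi>^2\<close>, from which the bound on
  \<open>\<psi>^2 / 2 - \<Xi>\<close> follows.\<close>

lemma test_functions:
  obtains G \<Xi> \<epsilon> where "\<And>s. (G has_real_derivative (\<psi>' s)\<^sup>2) (at s)" "\<And>s. (\<Xi> has_real_derivative G s) (at s)"
    "0 < \<epsilon>" "\<And>s. 0 \<le> s \<Longrightarrow> f s * G s \<le> (1 - \<epsilon>) * \<Psi> s"
    "\<And>s. 0 \<le> s \<Longrightarrow> \<bar>(\<psi> s)\<^sup>2 / 2 - \<Xi> s\<bar> \<le> (\<psi> s)\<^sup>2 / 2"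
proof -
  obtain G where G: "\<And>s. (G has_real_derivative (\<psi>' s)\<^sup>2) (at s)" "G 0 = 0"
    using continuous_antiderivative[of "\<lambda>s. (\<psi>' s)\<^sup>2"] continuous_\<psi>' by (auto intro: continuous_intros)
  have "continuous_on UNIV G" by (rule DERIV_continuous_on[OF has_field_derivative_at_within[OF G(1)]])
  then obtain \<Xi> where \<Xi>: "\<And>s. (\<Xi> has_real_derivative G s) (at s)" "\<Xi> 0 = 0"
    using continuous_antiderivative by blast
  obtain \<epsilon> where eps: "0 < \<epsilon>" "\<epsilon> \<le> 1" "\<And>s. 0 < s \<Longrightarrow> G s \<le> (1 - \<epsilon>) * W s" using G_le_W[OF G] by blast
  have G_nonneg: "0 \<le> G s" if "0 \<le> s" for s
    using deriv_nonneg_imp_mono[of 0 s G "\<lambda>s. (\<psi>' s)\<^sup>2"] G that by simp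
  have \<Xi>_nonneg: "0 \<le> \<Xi> s" if "0 \<le> s" for s
    using deriv_nonneg_imp_mono[of 0 s \<Xi> G] \<Xi> G_nonneg that by simp
  have G_le: "G s \<le> 2 * \<psi> s * \<psi>' s" if "0 \<le> s" for s
  proof (cases "s = 0")
    case False
    then have s: "0 < s" using that by simp
    have "G s \<le> (1 - \<epsilon>) * W s" using eps s by blast
    also have "\<dots> \<le> 1 * W s" using eps W_pos[OF s] by (intro mult_right_mono) auto
    also have "\<dots> \<le> 1 * (\<psi> s * \<psi>' s)" using W_le[OF s] by simp
    also have "\<dots> \<le> 2 * (\<psi> s * \<psi>' s)" using \<psi>_pos[OF s] \<psi>'_nonneg[of s] by (intro mult_right_mono) auto
    finally show ?thesis by (simp add: mult.assoc)
  qed (simp add: G \<psi>_0)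
  have \<Xi>_le: "\<Xi> s \<le> (\<psi> s)\<^sup>2" if s: "0 \<le> s" for s
  proof -
    have "((\<lambda>s. (\<psi> s)\<^sup>2 - \<Xi> s) has_real_derivative 2 * \<psi> s * \<psi>' s - G s) (at s)" for s
      by (auto intro!: derivative_eq_intros deriv_\<psi> \<Xi>)
    from deriv_nonneg_imp_mono[of 0 s, OF this] G_le s
    show ?thesis by (simp add: \<psi>_0 \<Xi>)
  qed
  show ?thesis
  proof (rule that[OF G(1) \<Xi>(1) eps(1)])
    fix s :: real assume s: "0 \<le> s"
    show "\<bar>(\<psi> s)\<^sup>2 / 2 - \<Xi> s\<bar> \<le> (\<psi> s)\<^sup>2 / 2" using \<Xi>_nonneg[OF s] \<Xi>_le[OF s] by linarith
    show "f s * G s \<le> (1 - \<epsilon>) * \<Psi> s"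
    proof (cases "s = 0")
      case False
      then have "f s * G s \<le> f s * ((1 - \<epsilon>) * W s)" using eps pos[of s] s by (intro mult_left_mono) auto
      also have "\<dots> = (1 - \<epsilon>) * \<Psi> s" using False pos[of s] s by (simp add: W_def \<Psi>_def)
      finally show ?thesis .
    qed (simp add: f0 \<Psi>_def)
  qed
qed

text \<open>From \<open>f' \<ge> k * f powr r\<close> and
  \<open>\<psi> = C * f powr \<alpha>\<close> it follows that \<open>f' * \<psi>^2\<close> dominates
  a multiple of \<open>\<psi>^2\<close> to the power \<open>1 + r / (2 * \<alpha>)\<close>. At
  infinity \<open>r1\<close> serves for this and for the gap condition; near 0 the growth bound
  takes an upper bound \<open>r2\<close> of \<open>1 / q\<close> in place of the lower bound
  \<open>r0\<close>.\<close>

lemma \<Psi>_growth: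
  assumes r: "0 < r2" and near: "\<And>s. 0 < s \<Longrightarrow> s \<le> a \<Longrightarrow> f s * f'' s \<le> r2 * (f' s)\<^sup>2"
  obtains c where "0 < c" "\<And>s. 0 \<le> s \<Longrightarrow>
    c * (\<psi> s)\<^sup>2 powr (1 + r2 / (2 * \<alpha>0)) \<le> \<Psi> s \<or> c * (\<psi> s)\<^sup>2 powr (1 + r1 / (2 * \<alpha>1)) \<le> \<Psi> s"
proof -
  have r1: "0 < r1" using \<alpha>1 by (smt (verit) zero_le_power2)
  obtain c0 where c0: "0 < c0" "\<And>s. 0 < s \<Longrightarrow> s \<le> a \<Longrightarrow> c0 * f s powr r2 \<le> f' s"
    using deriv_ge_powr_at_0[OF ab(1) deriv_pos[OF f0 ab(1)] near] by blast
  have b: "0 < b" using ab by simp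
  obtain c1 where c1: "0 < c1" "\<And>s. b \<le> s \<Longrightarrow> c1 * f s powr r1 \<le> f' s"
    using deriv_ge_powr_at_top[OF b deriv_pos[OF f0 b] ratio_at_top] by blast
  obtain C0 where C0: "0 < C0" "\<And>s. 0 < s \<Longrightarrow> ln (f s) \<le> ln (f a) - 1 \<Longrightarrow> \<psi> s = C0 * f s powr \<alpha>0"
    using \<psi>_at_0 by blast
  obtain C1 where C1: "0 < C1" "\<And>s. 0 < s \<Longrightarrow> ln (f b) + 1 \<le> ln (f s) \<Longrightarrow> \<psi> s = C1 * f s powr \<alpha>1"
    using \<psi>_at_top by blast
  obtain s0 where s0: "0 < s0" "s0 \<le> a" "ln (f s0) \<le> ln (f a) - 1"
    using eventually_happens'[OF _ eventually_at_0] by auto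
  define M where "M = exp (\<Lambda> (ln (f b) + 1))"
  define k0 where "k0 = c0 * C0 powr (- r2 / \<alpha>0)"
  define k1 where "k1 = c1 * C1 powr (- r1 / \<alpha>1)"
  \<comment> \<open>Constant for the bounded middle range, where \<open>f' \<ge> f' s0\<close> and
    \<open>\<psi> \<le> M\<close>; the first alternative holds there.\<close>
  define k2 where "k2 = f' s0 * (M\<^sup>2) powr (- r2 / (2 * \<alpha>0))"
  define c where "c = Min {k0, k1, k2}"
  have M: "0 < M" by (simp add: M_def)
  have c: "0 < c" "c \<le> k0" "c \<le> k1" "c \<le> k2"
    using c0 c1 C0 C1 deriv_pos[OF f0 s0(1)] M by (auto simp: c_def k0_def k1_def k2_def)
  have power: "k * C powr (- r / \<alpha>) * (\<psi> s)\<^sup>2 powr (1 + r / (2 * \<alpha>)) \<le> \<Psi> s"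
    if s: "0 < s" and k: "k * f s powr r \<le> f' s" and C: "0 < C" "\<psi> s = C * f s powr \<alpha>" "0 < \<alpha>" for k C r \<alpha> s
  proof -
    have "(\<psi> s)\<^sup>2 powr (r / (2 * \<alpha>)) = \<psi> s powr (r / \<alpha>)"
      using \<psi>_pos[OF s] C by (simp add: powr_powr flip: powr_numeral)
    also have "\<dots> = C powr (r / \<alpha>) * f s powr r"
      unfolding C(2) using C pos[OF s] by (simp add: powr_mult powr_powr)
    finally have "k * C powr (- r / \<alpha>) * (\<psi> s)\<^sup>2 powr (1 + r / (2 * \<alpha>)) = (k * f s powr r) * (\<psi> s)\<^sup>2"
      using C by (simp add: powr_add powr_minus)
    also have "\<dots> \<le> f' s * (\<psi> s)\<^sup>2" using k by (intro mult_right_mono) auto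
    finally show ?thesis using s by (simp add: \<Psi>_def)
  qed
  show ?thesis
  proof (rule that[OF c(1)])
    fix s :: real assume s: "0 \<le> s"
    have mono: "c * (\<psi> s)\<^sup>2 powr e \<le> k * (\<psi> s)\<^sup>2 powr e" if "c \<le> k" for k e
      using that by (intro mult_right_mono) auto
    consider "s = 0" | "0 < s" "s \<le> s0" | "0 < s" "ln (f b) + 1 \<le> ln (f s)" | "s0 \<le> s" "ln (f s) \<le> ln (f b) + 1"
      using s by linarith
    then show "c * (\<psi> s)\<^sup>2 powr (1 + r2 / (2 * \<alpha>0)) \<le> \<Psi> s \<or> c * (\<psi> s)\<^sup>2 powr (1 + r1 / (2 * \<alpha>1)) \<le> \<Psi> s"
    proof cases
      case 1
      then show ?thesis by (simp add: \<psi>_0 \<Psi>_def)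
    next
      case 2
      have "ln (f s) \<le> ln (f a) - 1" using ln_mono_pos[OF 2] s0 by linarith
      then have "k0 * (\<psi> s)\<^sup>2 powr (1 + r2 / (2 * \<alpha>0)) \<le> \<Psi> s"
        unfolding k0_def using 2 s0 \<alpha>0 C0 c0 by (intro power) auto
      then show ?thesis using mono[OF c(2), of "1 + r2 / (2 * \<alpha>0)"] by linarith
    next
      case 3
      have "b \<le> s"
      proof (rule ccontr)
        assume "\<not> b \<le> s"
        then show False using ln_mono_pos[of s b] 3 by simp
      qed
      then have "k1 * (\<psi> s)\<^sup>2 powr (1 + r1 / (2 * \<alpha>1)) \<le> \<Psi> s"
        unfolding k1_def using 3 \<alpha>1 C1 c1 by (intro power) auto
      then show ?thesis using mono[OF c(3), of "1 + r1 / (2 * \<alpha>1)"] by linarith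
    next
      case 4
      have sp: "0 < s" using 4 s0 by simp
      have \<psi>M: "(\<psi> s)\<^sup>2 \<le> M\<^sup>2" using \<Lambda>_mono[OF 4(2)] sp by (intro power_mono) (simp_all add: M_def \<psi>_def)
      have "(\<psi> s)\<^sup>2 powr (r2 / (2 * \<alpha>0)) \<le> (M\<^sup>2) powr (r2 / (2 * \<alpha>0))"
        using \<psi>M r \<alpha>0 by (intro powr_mono2) auto
      then have "(M\<^sup>2) powr (- r2 / (2 * \<alpha>0)) * (\<psi> s)\<^sup>2 powr (r2 / (2 * \<alpha>0)) \<le> 1"
        using M by (simp add: powr_minus field_simps)
      then have "f' s0 * (\<psi> s)\<^sup>2 * ((M\<^sup>2) powr (- r2 / (2 * \<alpha>0)) * (\<psi> s)\<^sup>2 powr (r2 / (2 * \<alpha>0))) \<le> f' s0 * (\<psi> s)\<^sup>2 * 1"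
        using deriv1_nonneg[OF s0(1)] by (intro mult_left_mono) auto
      also have "\<dots> \<le> \<Psi> s" using deriv_mono[OF s0(1) 4(1)] sp by (simp add: \<Psi>_def mult_right_mono)
      finally have "k2 * (\<psi> s)\<^sup>2 powr (1 + r2 / (2 * \<alpha>0)) \<le> \<Psi> s"
        by (simp add: k2_def powr_add mult_ac)
      then show ?thesis using mono[OF c(4), of "1 + r2 / (2 * \<alpha>0)"] by linarith
    qed
  qed
qed

end

section \<open>Growth of the nonlinearity and the dimension condition\<close>

context nonlinearity
begin

lemma nonneg_0: "0 \<le> f 0"
proof (rule tendsto_lowerbound[OF tendsto_0])
  show "\<forall>\<^sub>F s in at_right 0. 0 \<le> f s"
    using eventually_at_right_less[of "0::real"] by eventually_elim (auto dest: pos)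
qed simp

lemma mono_0: "0 \<le> s \<Longrightarrow> f 0 \<le> f s"
proof (cases "s = 0")
  case False
  assume "0 \<le> s"
  with False have s: "0 < s" by simp
  have "\<forall>\<^sub>F t in at_right 0. f t \<le> f s"
    using eventually_at_right_real[OF s] by eventually_elim (auto intro: mono_pos)
  then show ?thesis using tendsto_upperbound[OF tendsto_0] by simp
qed simp

text \<open>The derivative \<open>(1 - r) * f powr (- r) * f'\<close> of
  \<open>f powr (1 - r)\<close> is at least \<open>(1 - r) * c\<close> between \<open>t\<close> and
  \<open>s\<close>.\<close>

lemma powr_increment:
  assumes ts: "0 < t" "t \<le> s" and le: "\<And>x. t \<le> x \<Longrightarrow> x \<le> s \<Longrightarrow> c * f x powr r \<le> f' x" and r: "r \<le> 1"
  shows "(1 - r) * c * (s - t) \<le> f s powr (1 - r)"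
proof -
  have "f t powr (1 - r) - (1 - r) * c * t \<le> f s powr (1 - r) - (1 - r) * c * s"
  proof (rule deriv_nonneg_imp_mono[where g="\<lambda>x. f x powr (1 - r) - (1 - r) * c * x"
        and g'="\<lambda>x. (1 - r) * f x powr (- r) * f' x - (1 - r) * c"])
    fix x assume x: "x \<in> {t..s}"
    then have p: "0 < x" "0 < f x" using ts pos by auto
    show "((\<lambda>x. f x powr (1 - r) - (1 - r) * c * x) has_real_derivative (1 - r) * f x powr (- r) * f' x - (1 - r) * c) (at x)"
      using p by (auto intro!: derivative_eq_intros deriv1)
    have "f x powr (- r) * (c * f x powr r) \<le> f x powr (- r) * f' x"
      using le[of x] x by (intro mult_left_mono) auto
    then have "c \<le> f x powr (- r) * f' x" using p by (simp add: powr_minus field_simps)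
    then have "(1 - r) * c \<le> (1 - r) * (f x powr (- r) * f' x)" using r by (intro mult_left_mono) auto
    then show "0 \<le> (1 - r) * f x powr (- r) * f' x - (1 - r) * c" by (simp add: mult.assoc)
  qed (rule ts)
  then show ?thesis by (smt (verit) powr_ge_zero right_diff_distrib)
qed

text \<open>Integrating \<open>f' \<ge> c * f powr (1 / Q)\<close> gives the power
  \<open>Q / (Q - 1) = 1 + 1 / (Q - 1)\<close>. At infinity this differential inequality comes from
  \<open>q \<le> Q\<close>, near 0 from \<open>q \<ge> Q\<close>. In between a positive lower bound
  on \<open>f\<close> suffices, and if \<open>f 0 > 0\<close> this bound also covers the
  neighbourhood of 0.\<close>

lemma superlinear_growth:
  assumes Q: "1 < Q" and b: "0 < b" "0 < f' b" and top: "\<And>s. b \<le> s \<Longrightarrow> 1 / Q * (f' s)\<^sup>2 \<le> f s * f'' s"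
    and near: "0 < f 0 \<or> (f 0 = 0 \<and> (\<exists>a>0. \<forall>s. 0 < s \<longrightarrow> s \<le> a \<longrightarrow> f s * f'' s \<le> 1 / Q * (f' s)\<^sup>2))"
  obtains c where "0 < c" "\<And>s. 0 \<le> s \<Longrightarrow> c * s powr (1 + 1 / (Q - 1)) \<le> f s"
proof -
  define e where "e = 1 + 1 / (Q - 1)"
  have e: "0 < e" "(1 - 1 / Q) * e = 1" using Q by (auto simp: e_def field_simps)
  \<comment> \<open>\<open>t \<le> s / 2\<close> leaves an interval of length at least
    \<open>s / 2\<close> for the integration. It is applied with \<open>t = b\<close> for large
    \<open>s\<close> and with \<open>t = s / 2\<close> near 0.\<close>
  have half: "((1 - 1 / Q) * c / 2) powr e * s powr e \<le> f s"
    if "0 < c" "0 < t" "t \<le> s / 2" "\<And>x. t \<le> x \<Longrightarrow> x \<le> s \<Longrightarrow> c * f x powr (1 / Q) \<le> f' x" for c t s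
  proof -
    have s: "0 < s" "t \<le> s" using that by linarith+
    have k: "0 < (1 - 1 / Q) * c" using Q that by simp
    have "(1 - 1 / Q) * c * (s / 2) \<le> (1 - 1 / Q) * c * (s - t)"
      using k that by (intro mult_left_mono) auto
    also have "\<dots> \<le> f s powr (1 - 1 / Q)"
      using that s Q by (intro powr_increment) auto
    finally have "((1 - 1 / Q) * c / 2 * s) powr e \<le> (f s powr (1 - 1 / Q)) powr e"
      using k s e by (intro powr_mono2) auto
    also have "\<dots> = f s" using e pos[OF s(1)] by (simp add: powr_powr)
    finally show ?thesis using k s by (subst powr_mult[symmetric]) auto
  qed
  obtain c1 where c1: "0 < c1" "\<And>s. b \<le> s \<Longrightarrow> c1 * f s powr (1 / Q) \<le> f' s"
    using deriv_ge_powr_at_top[OF b top] by blast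
  define k1 where "k1 = ((1 - 1 / Q) * c1 / 2) powr e"
  have k1: "0 < k1" "k1 * s powr e \<le> f s" if "2 * b \<le> s" for s
    using half[OF c1(1) b(1), of s] c1 that Q by (auto simp: k1_def)
  \<comment> \<open>Common form of both alternatives. For \<open>f 0 > 0\<close> the choice
    \<open>a = 0\<close> makes the range of the power bound empty.\<close>
  have "\<exists>a k m. 0 \<le> a \<and> 0 < k \<and> (\<forall>s. 0 < s \<longrightarrow> s \<le> a \<longrightarrow> k * s powr e \<le> f s) \<and> 0 < m \<and> (\<forall>s\<ge>a. m \<le> f s)"
    using near
  proof
    assume "0 < f 0"
    then show ?thesis using mono_0 by (intro exI[of _ 0] exI[of _ 1] exI[of _ "f 0"]) auto
  next
    assume *: "f 0 = 0 \<and> (\<exists>a>0. \<forall>s. 0 < s \<longrightarrow> s \<le> a \<longrightarrow> f s * f'' s \<le> 1 / Q * (f' s)\<^sup>2)"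
    then obtain a where a: "0 < a" "\<And>s. 0 < s \<Longrightarrow> s \<le> a \<Longrightarrow> f s * f'' s \<le> 1 / Q * (f' s)\<^sup>2" by blast
    obtain c0 where c0: "0 < c0" "\<And>s. 0 < s \<Longrightarrow> s \<le> a \<Longrightarrow> c0 * f s powr (1 / Q) \<le> f' s"
      using deriv_ge_powr_at_0[OF a(1) deriv_pos[OF _ a(1)] a(2)] * by blast
    have "((1 - 1 / Q) * c0 / 2) powr e * s powr e \<le> f s" if "0 < s" "s \<le> a" for s
      using that by (intro half[OF c0(1), of "s / 2"] c0) auto
    moreover have "0 < ((1 - 1 / Q) * c0 / 2) powr e" using Q c0 by simp
    moreover have "\<forall>s\<ge>a. f a \<le> f s" using a by (auto intro: mono_pos)
    ultimately show ?thesis using a pos[of a]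
      by (intro exI[of _ a] exI[of _ "((1 - 1 / Q) * c0 / 2) powr e"] exI[of _ "f a"]) auto
  qed
  then obtain a k m where akm: "0 \<le> a" "0 < k" "\<And>s. 0 < s \<Longrightarrow> s \<le> a \<Longrightarrow> k * s powr e \<le> f s"
    "0 < m" "\<And>s. a \<le> s \<Longrightarrow> m \<le> f s" by blast
  define c where "c = Min {k, k1, m / (2 * b) powr e}"
  have c: "0 < c" "c \<le> k" "c \<le> k1" "c \<le> m / (2 * b) powr e" using akm k1[of "2 * b"] b by (auto simp: c_def)
  show ?thesis
  proof (rule that[OF c(1)])
    fix s :: real assume s: "0 \<le> s"
    consider "s = 0" | "0 < s" "s \<le> a" | "2 * b \<le> s" | "a \<le> s" "s \<le> 2 * b" "0 < s" using s by linarith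
    then have "c * s powr e \<le> f s"
    proof cases
      case 1
      then show ?thesis using nonneg_0 by simp
    next
      case 2
      have "c * s powr e \<le> k * s powr e" using c by (intro mult_right_mono) auto
      then show ?thesis using akm(3)[OF 2] by linarith
    next
      case 3
      have "c * s powr e \<le> k1 * s powr e" using c by (intro mult_right_mono) auto
      then show ?thesis using k1(2)[OF 3] by linarith
    next
      case 4
      have "c * s powr e \<le> m / (2 * b) powr e * (2 * b) powr e"
        using c 4 e akm by (intro mult_mono powr_mono2) auto
      also have "\<dots> = m" using b by simp
      finally show ?thesis using akm(5)[OF 4(1)] by linarith
    qed
    then show "c * s powr (1 + 1 / (Q - 1)) \<le> f s" by (simp add: e_def)
  qed
qed

end

section \<open>Bounds on \<open>q_fun\<close> read as differential inequalities\<close>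

lemma q_fun_less:
  assumes "q_fun f s < ereal q"
  shows "f s * deriv (deriv f) s \<noteq> 0" "(deriv f s)\<^sup>2 / (f s * deriv (deriv f) s) < q"
  using assms by (auto simp: q_fun_def split: if_splits)

lemma nonlinearity_q_less:
  assumes "nonlinearity f (deriv f) (deriv (deriv f))" "q_fun f s < ereal q" "0 < s"
  shows "0 < f s * deriv (deriv f) s" "(deriv f s)\<^sup>2 < q * (f s * deriv (deriv f) s)"
    "0 < q \<Longrightarrow> 1 / q * (deriv f s)\<^sup>2 \<le> f s * deriv (deriv f) s"
proof -
  interpret nonlinearity f "deriv f" "deriv (deriv f)" by fact
  show *: "0 < f s * deriv (deriv f) s"
    using q_fun_less(1)[OF assms(2)] pos[OF assms(3)] deriv2_nonneg[OF assms(3)]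
    by (metis less_eq_real_def mult_eq_0_iff mult_pos_pos)
  then show **: "(deriv f s)\<^sup>2 < q * (f s * deriv (deriv f) s)"
    using q_fun_less(2)[OF assms(2)] by (simp add: pos_divide_less_eq)
  show "1 / q * (deriv f s)\<^sup>2 \<le> f s * deriv (deriv f) s" if "0 < q"
    using ** that by (simp add: field_simps)
qed

lemma nonlinearity_q_greater:
  assumes "nonlinearity f (deriv f) (deriv (deriv f))" "ereal q < q_fun f s" "0 < s" "0 < q"
  shows "f s * deriv (deriv f) s \<le> 1 / q * (deriv f s)\<^sup>2"
proof -
  interpret nonlinearity f "deriv f" "deriv (deriv f)" by fact
  have nn: "0 \<le> f s * deriv (deriv f) s" using pos[OF assms(3)] deriv2_nonneg[OF assms(3)] by simp
  show ?thesis
  proof (cases "f s * deriv (deriv f) s = 0")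
    case True
    \<comment> \<open>Here \<open>q_fun\<close> has its default value infinity, and the left side is
      0.\<close>
    show ?thesis unfolding True using assms(4) by simp
  next
    case False
    then have "q < (deriv f s)\<^sup>2 / (f s * deriv (deriv f) s)" using assms(2) by (simp add: q_fun_def)
    then show ?thesis using nn False assms(4) by (simp add: field_simps)
  qed
qed

text \<open>If \<open>q < 1\<close> near \<open>0\<close>, then \<open>f / f'\<close> is nonincreasing there, while \<open>0 < f s / f' s \<le> s\<close>.\<close>

lemma nonlinearity_q0_ge_1:
  assumes nl: "nonlinearity f (deriv f) (deriv (deriv f))" and f0: "f 0 = 0"
    and lim: "(q_fun f \<longlongrightarrow> q\<^sub>0) (at_right 0)"
  shows "1 \<le> q\<^sub>0"
proof (rule ccontr)
  interpret nonlinearity f "deriv f" "deriv (deriv f)" by fact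
  assume "\<not> 1 \<le> q\<^sub>0"
  then have "\<forall>\<^sub>F s in at_right 0. q_fun f s < 1" using lim by (intro order_tendstoD(2)) auto
  then obtain d where d: "0 < d" "\<And>s. 0 < s \<Longrightarrow> s < d \<Longrightarrow> q_fun f s < ereal 1"
    by (auto simp: eventually_at_right_field one_ereal_def)
  define s where "s = d / 2"
  have s: "0 < s" "s < d" using d by (auto simp: s_def)
  define g where "g x = f x / deriv f x" for x
  have mono: "g s \<le> g t" if t: "0 < t" "t \<le> s" for t
  proof (rule DERIV_nonpos_imp_nonincreasing[OF t(2)])
    fix x assume x: "t \<le> x" "x \<le> s"
    then have p: "0 < x" "x < d" "0 < deriv f x" using t s deriv_pos[OF f0] by auto
    have "(g has_real_derivative (deriv f x * deriv f x - f x * deriv (deriv f) x) / (deriv f x * deriv f x)) (at x)"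
      unfolding g_def[abs_def] using p by (auto intro!: derivative_eq_intros deriv1 deriv2)
    moreover have "(deriv f x * deriv f x - f x * deriv (deriv f) x) / (deriv f x * deriv f x) \<le> 0"
      using nonlinearity_q_less(2)[OF nl d(2)[OF p(1,2)] p(1)] p
      by (intro divide_nonpos_pos) (auto simp: power2_eq_square)
    ultimately show "\<exists>y. (g has_real_derivative y) (at x) \<and> y \<le> 0" by blast
  qed
  have "g s > 0" using pos[OF s(1)] deriv_pos[OF f0 s(1)] by (simp add: g_def)
  have le: "g t \<le> t" if "0 < t" for t
    using tangent_0[OF that] deriv_pos[OF f0 that] f0 by (simp add: g_def field_simps)
  \<comment> \<open>Chosen below \<open>g s\<close>, which contradicts
    \<open>g s \<le> g t \<le> t\<close>.\<close>
  define t where "t = min s (g s / 2)"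
  have "0 < t" "t \<le> s" "t < g s" using s \<open>g s > 0\<close> by (auto simp: t_def min_def)
  then show False using mono[of t] le[of t] by simp
qed

section \<open>Conjugate exponents and the critical dimension\<close>

lemma conj_exponent_gt_1:
  assumes "1 < conj_exponent q"
  obtains r where "q = ereal r" "1 \<le> r"
proof (cases q)
  case (real r)
  have "1 \<le> r"
  proof (rule ccontr)
    assume r: "\<not> 1 \<le> r"
    \<comment> \<open>For \<open>r < 1\<close> the conjugate exponent \<open>1 + 1 / (r - 1)\<close>
      is below 1.\<close>
    then have "conj_exponent q = ereal (r / (r - 1))" using real by (simp add: conj_exponent_def one_ereal_def)
    then have "1 < r / (r - 1)" using assms by (simp add: one_ereal_def)
    then show False using r by (simp add: less_divide_eq)
  qed
  then show ?thesis using that real by blast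
qed (use assms in \<open>auto simp: conj_exponent_def\<close>)

text \<open>With \<open>\<rho>^2 = N - 1\<close> numerator and denominator share the factor
  \<open>(\<rho> - 1) * (\<rho> + 3)\<close>. The remaining quotient shows that \<open>p_c N\<close>
  is the conjugate exponent of \<open>(\<rho> - 1)^2 / 4\<close>.\<close>

lemma p_c_eq:
  assumes "11 \<le> N" and "\<rho> = sqrt (real N - 1)"
  shows "p_c N = (\<rho> - 1)\<^sup>2 / ((\<rho> - 1)\<^sup>2 - 4)"
proof -
  have N: "real N = \<rho>\<^sup>2 + 1" using assms by simp
  have "sqrt 9 < \<rho>" unfolding assms(2) using assms(1) by (intro real_sqrt_less_mono) simp
  then have \<rho>: "3 < \<rho>" by simp
  have num: "(\<rho>\<^sup>2 + 1 - 2)\<^sup>2 - 4 * (\<rho>\<^sup>2 + 1) + 8 * \<rho> = (\<rho> - 1)\<^sup>2 * ((\<rho> - 1) * (\<rho> + 3))" by algebra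
  have den: "(\<rho>\<^sup>2 + 1 - 2) * (\<rho>\<^sup>2 + 1 - 10) = ((\<rho> - 1)\<^sup>2 - 4) * ((\<rho> - 1) * (\<rho> + 3))" by algebra
  show ?thesis unfolding p_c_def assms(2)[symmetric] unfolding N num den using \<rho> by simp
qed

text \<open>The right side is \<open>(2 * sqrt q + 1)^2 + 1\<close>. For \<open>N \<ge> 11\<close>
  and \<open>\<rho>^2 = N - 1\<close> the claim is thus \<open>(\<rho> - 1)^2 / 4 < q\<close>, which
  is \<open>p < p_c N\<close> for the conjugate exponents. At \<open>q = 1\<close> the right side
  equals 10, so that \<open>N = 10\<close> requires \<open>q > 1\<close>, a finite conjugate
  exponent.\<close>

lemma dimension_bound:
  assumes q: "1 \<le> q"
    and c: "N \<le> 9 \<or> (N = 10 \<and> conj_exponent (ereal q) < \<infinity>) \<or> (11 \<le> N \<and> conj_exponent (ereal q) < ereal (p_c N))"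
  shows "real N < 2 + 4 * q + 4 * sqrt q"
proof -
  have s1: "1 \<le> sqrt q" using q by simp
  have q1: "1 < q" if "\<not> N \<le> 9"
    using c that q by (cases "q = 1") (auto simp: conj_exponent_def one_ereal_def)
  consider "N \<le> 9" | "N = 10" | "11 \<le> N" by linarith
  then show ?thesis
  proof cases
    case 1
    then have "real N \<le> 9" by simp
    then show ?thesis using s1 q by linarith
  next
    case 2
    then have "1 < q" "1 < sqrt q" using q1 2 by simp_all
    then show ?thesis unfolding 2 by linarith
  next
    case 3
    have q1: "1 < q" using q1 3 by simp
    then have "conj_exponent (ereal q) = ereal (q / (q - 1))" by (simp add: conj_exponent_def one_ereal_def)
    then have pc: "q / (q - 1) < p_c N" using c 3 by simp
    define \<rho> where "\<rho> = sqrt (real N - 1)"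
    have N: "real N = \<rho>\<^sup>2 + 1" using 3 by (simp add: \<rho>_def)
    have "sqrt 9 < \<rho>" unfolding \<rho>_def using 3 by (intro real_sqrt_less_mono) simp
    then have \<rho>: "3 < \<rho>" by simp
    have Qc: "4 < (\<rho> - 1)\<^sup>2" using power_strict_mono[of 2 "\<rho> - 1" 2] \<rho> by simp
    have "q / (q - 1) < (\<rho> - 1)\<^sup>2 / ((\<rho> - 1)\<^sup>2 - 4)" using pc p_c_eq[OF 3 \<rho>_def] by simp
    then have "(\<rho> - 1)\<^sup>2 < 4 * q" using q1 Qc by (simp add: divide_less_eq less_divide_eq field_simps)
    then have "sqrt ((\<rho> - 1)\<^sup>2) < sqrt (4 * q)" by (rule real_sqrt_less_mono)
    then have "\<rho> < 2 * sqrt q + 1" using \<rho> by (simp add: real_sqrt_mult)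
    then have "\<rho>\<^sup>2 < (2 * sqrt q + 1)\<^sup>2" using \<rho> by (intro power_strict_mono) auto
    also have "\<dots> = 4 * (sqrt q)\<^sup>2 + 4 * sqrt q + 1" by (simp add: power2_eq_square algebra_simps)
    finally show ?thesis using N q by simp
  qed
qed

text \<open>As \<open>t\<close> decreases to 1, the right side tends to
  \<open>2 + 4 * q + 4 * sqrt q\<close>. The parameter \<open>t\<close> is the room for taking
  \<open>\<alpha>0 = 1 + 1 / (t^2 * sqrt q)\<close> and for bounding \<open>q_fun\<close> near 0
  from below by \<open>q / t^2\<close>.\<close>

lemma dimension_margin:
  assumes q: "1 \<le> q" and N: "N < 2 + 4 * q + 4 * sqrt q"
  obtains t where "1 < t" "N < 2 * (1 + 2 * (1 + 1 / (t\<^sup>2 * sqrt q)) * (q / t\<^sup>2))"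
proof -
  have "((\<lambda>t. 2 * (1 + 2 * (1 + 1 / (t\<^sup>2 * sqrt q)) * (q / t\<^sup>2))) \<longlongrightarrow>
      2 * (1 + 2 * (1 + 1 / (1\<^sup>2 * sqrt q)) * (q / 1\<^sup>2))) (at_right 1)"
    using q by (intro tendsto_intros) auto
  also have "2 * (1 + 2 * (1 + 1 / (1\<^sup>2 * sqrt q)) * (q / 1\<^sup>2)) = 2 + 4 * q + 4 * sqrt q"
    using q by (simp add: field_simps real_div_sqrt)
  finally have "\<forall>\<^sub>F t in at_right 1. N < 2 * (1 + 2 * (1 + 1 / (t\<^sup>2 * sqrt q)) * (q / t\<^sup>2))"
    using N by (rule order_tendstoD(1))
  then have "\<forall>\<^sub>F t in at_right 1. 1 < t \<and> N < 2 * (1 + 2 * (1 + 1 / (t\<^sup>2 * sqrt q)) * (q / t\<^sup>2))"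
    using eventually_at_right_less[of "1::real"] by eventually_elim simp
  then show ?thesis using that eventually_happens'[OF trivial_limit_at_right_real] by blast
qed

section \<open>The two regimes of the nonlinearity and their combination\<close>

lemma nonlinearity_deriv:
  assumes cont: "continuous_on {0..} f"
    and C2: "f C1_differentiable_on {0<..}" "deriv f C1_differentiable_on {0<..}"
    and mono: "mono_on {0..} f" and convex: "convex_on {0..} f"
    and pos: "\<And>s. s > 0 \<Longrightarrow> f s > 0"
  shows "nonlinearity f (deriv f) (deriv (deriv f))"
proof
  show d1: "(f has_real_derivative deriv f s) (at s)" if "0 < s" for s
    using C2(1) that by (auto simp: C1_differentiable_on_eq DERIV_deriv_iff_real_differentiable)
  show d2: "(deriv f has_real_derivative deriv (deriv f) s) (at s)" if "0 < s" for s
    using C2(2) that by (auto simp: C1_differentiable_on_eq DERIV_deriv_iff_real_differentiable)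
  show "0 \<le> deriv f s" if "0 < s" for s
    by (rule mono_on_imp_deriv_nonneg[OF mono d1[OF that]]) (use that in \<open>simp add: interior_Ici\<close>)
  have tangent: "deriv f s * (t - s) \<le> f t - f s" if "0 < s" "0 < t" for s t
    using that d1[OF that(1)]
    by (intro convex_on_imp_above_tangent[OF convex]) (auto intro: has_field_derivative_at_within)
  have "mono_on {0<..} (deriv f)"
  proof (rule mono_onI)
    fix s t :: real assume st: "s \<in> {0<..}" "t \<in> {0<..}" "s \<le> t"
    \<comment> \<open>Sum of the tangent inequalities at \<open>s\<close> and at
      \<open>t\<close>.\<close>
    then have "deriv f s * (t - s) \<le> deriv f t * (t - s)"
      using tangent[of s t] tangent[of t s] by (simp add: algebra_simps)
    then show "deriv f s \<le> deriv f t" using st by (cases "s = t") auto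
  qed
  then show "0 \<le> deriv (deriv f) s" if "0 < s" for s
    by (rule mono_on_imp_deriv_nonneg[OF _ d2[OF that]]) (use that in \<open>simp add: interior_open\<close>)
qed (use cont pos in auto)

text \<open>Superlinear growth feeds the vanishing criterion with \<open>A = f(u)\<close>,
  \<open>X = u\<close> and \<open>d = 1 / (Q - 1)\<close>, whose dimension condition reads
  \<open>N < 2 * Q\<close>. Since \<open>Q\<close> may be taken as large as desired, every dimension
  is covered.\<close>

lemma trivial_solution_superlinear:
  fixes f :: "real \<Rightarrow> real" and u :: "real ^ 'n::finite \<Rightarrow> real"
  assumes nl: "nonlinearity f (deriv f) (deriv (deriv f))"
    and lim: "(q_fun f \<longlongrightarrow> q\<^sub>0) (at_right 0)"
    and qinf: "Limsup at_top (q_fun f) < \<infinity>"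
    and near: "0 < f 0 \<or> (f 0 = 0 \<and> q\<^sub>0 = \<infinity>)"
    and u: "\<And>x. 0 \<le> u x" and sol: "solution f u"
  shows "u x = 0"
proof -
  interpret nonlinearity f "deriv f" "deriv (deriv f)" by fact
  obtain Q1 where Q1: "Limsup at_top (q_fun f) < ereal Q1"
    using ereal_dense2[OF qinf] by blast
  \<comment> \<open>At least \<open>Q1\<close> for the bound at infinity, at least the dimension for
    \<open>N < 2 * Q\<close>, and at least 2 for \<open>Q > 1\<close>.\<close>
  define Q where "Q = max Q1 (max 2 (real CARD('n)))"
  have Q: "1 < Q" "real CARD('n) \<le> Q" "Q1 \<le> Q" by (auto simp: Q_def)
  have "\<forall>\<^sub>F s in at_top. q_fun f s < ereal Q1" using Q1 by (rule Limsup_lessD)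
  then have "\<forall>\<^sub>F s in at_top. q_fun f s < ereal Q"
    by eventually_elim (use Q(3) in \<open>auto elim: less_le_trans\<close>)
  then obtain b0 where b0: "\<And>s. b0 \<le> s \<Longrightarrow> q_fun f s < ereal Q" by (auto simp: eventually_at_top_linorder)
  define b where "b = max b0 1 + 1"
  have b: "0 < b" "1 \<le> b - 1" "b0 \<le> b - 1" by (auto simp: b_def)
  \<comment> \<open>\<open>f\<close> may be constant near 0 when \<open>f 0 > 0\<close>. Finite
    \<open>q_fun\<close> at large arguments forces \<open>f'' > 0\<close> there, so
    \<open>f'\<close> is positive after one more unit step.\<close>
  have "0 < deriv f b"
  proof -
    have "\<exists>z. b - 1 < z \<and> z < b \<and> deriv f b - deriv f (b - 1) = (b - (b - 1)) * deriv (deriv f) z"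
      using b by (intro MVT2 deriv2) auto
    then obtain z where z: "b - 1 < z" "deriv f b - deriv f (b - 1) = deriv (deriv f) z" by auto
    then have "0 < deriv (deriv f) z"
      using nonlinearity_q_less(1)[OF nl b0[of z]] pos[of z] b by (simp add: zero_less_mult_iff)
    then show ?thesis using z deriv1_nonneg[of "b - 1"] b by simp
  qed
  moreover have "1 / Q * (deriv f s)\<^sup>2 \<le> f s * deriv (deriv f) s" if "b \<le> s" for s
    using that b Q b0 by (intro nonlinearity_q_less(3)[OF nl]) auto
  moreover have "0 < f 0 \<or> (f 0 = 0 \<and> (\<exists>a>0. \<forall>s. 0 < s \<longrightarrow> s \<le> a \<longrightarrow> f s * deriv (deriv f) s \<le> 1 / Q * (deriv f s)\<^sup>2))"
    using near
  proof
    assume *: "f 0 = 0 \<and> q\<^sub>0 = \<infinity>"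
    then have "\<forall>\<^sub>F s in at_right 0. ereal Q < q_fun f s" using lim by (intro order_tendstoD(1)) auto
    then obtain d where d: "0 < d" "\<And>s. 0 < s \<Longrightarrow> s < d \<Longrightarrow> ereal Q < q_fun f s"
      by (auto simp: eventually_at_right_field)
    have "\<forall>s. 0 < s \<longrightarrow> s \<le> d / 2 \<longrightarrow> f s * deriv (deriv f) s \<le> 1 / Q * (deriv f s)\<^sup>2"
      using d Q by (intro allI impI nonlinearity_q_greater[OF nl]) auto
    then show ?thesis using * d(1) by (intro disjI2 conjI exI[of _ "d / 2"]) auto
  qed simp
  ultimately obtain c where c: "0 < c" "\<And>s. 0 \<le> s \<Longrightarrow> c * s powr (1 + 1 / (Q - 1)) \<le> f s"
    using superlinear_growth[OF Q(1) b(1)] by blast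
  have C2u: "C2 u" and eq: "- laplacian u x = f (u x)" for x using sol by (auto simp: solution_def)
  have fu0: "0 \<le> f (u x)" for x using c(2)[OF u] c(1) by (smt (verit) mult_nonneg_nonneg powr_ge_zero)
  have d: "real CARD('n) < 2 * (1 + 1 / (1 / (Q - 1)))" using Q by simp
  have "f (u x) = 0"
  proof (rule vanishing_of_cutoff_estimate[where A="\<lambda>x. f (u x)" and X=u and c=c
        and ?d1.0="1 / (Q - 1)" and ?d2.0="1 / (Q - 1)"])
    show "continuous_on UNIV (\<lambda>x. f (u x))"
      using u by (intro continuous_on_compose2[OF cont C1_continuous[OF C2_C1(1)[OF C2u]]]) auto
    show "continuous_on UNIV u" using C1_continuous[OF C2_C1(1)[OF C2u]] .
    show "\<exists>K. \<forall>R\<ge>1. (LINT x|lborel. f (u x) * cutoff R (2 * k) x)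
        \<le> K / R\<^sup>2 * (LINT x|lborel. u x * cutoff R (2 * k - 2) x)" if "3 \<le> k" for k
      using supersolution_cutoff_estimate[OF C2u u that] unfolding eq by blast
  qed (use u fu0 c Q d in auto)
  \<comment> \<open>Only 0 can be a zero of \<open>f\<close> on the nonnegative half-line. If
    \<open>f 0 > 0\<close>, the situation is contradictory and the same argument concludes.\<close>
  then show ?thesis using pos[of "u x"] u[of x] by fastforce
qed

text \<open>Both exponents lie just below the threshold \<open>1 + 1 / sqrt q\<close>, at which
  \<open>(\<alpha> - 1)^2 = 1 / q\<close>. The number \<open>t > 1\<close> measures this distance as
  well as the tolerance for \<open>q_fun\<close> around \<open>q0\<close> and above
  \<open>q1\<close>.\<close>

lemma trivial_solution_stable:
  fixes f :: "real \<Rightarrow> real" and u :: "real ^ 'n::finite \<Rightarrow> real"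
  assumes nl: "nonlinearity f (deriv f) (deriv (deriv f))" and f0: "f 0 = 0"
    and lim: "(q_fun f \<longlongrightarrow> ereal q0) (at_right 0)" and q0: "1 \<le> q0"
    and qinf: "Limsup at_top (q_fun f) = ereal q1" and q1: "1 \<le> q1"
    and dim: "real CARD('n) < 2 + 4 * q0 + 4 * sqrt q0" "real CARD('n) < 2 + 4 * q1 + 4 * sqrt q1"
    and u: "\<And>x. 0 \<le> u x" and sol: "solution f u" and stable: "is_stable f u"
  shows "u x = 0"
proof -
  interpret nonlinearity f "deriv f" "deriv (deriv f)" by fact
  obtain t where t: "1 < t" "real CARD('n) < 2 * (1 + 2 * (1 + 1 / (t\<^sup>2 * sqrt q0)) * (q0 / t\<^sup>2))"
    using dimension_margin[OF q0 dim(1)] by blast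
  have t2: "1 < t\<^sup>2" using t by (simp add: one_less_power)
  have tp: "0 < q0 * t\<^sup>2" "0 < q1 * t\<^sup>2" "0 < q0 / t\<^sup>2" using t q0 q1 by simp_all
  have less: "q0 < q0 * t\<^sup>2" "q1 < q1 * t\<^sup>2" using t2 q0 q1 by simp_all
  moreover have "q0 / t\<^sup>2 < q0"
    by (rule iffD2[OF pos_divide_less_eq less(1)]) (use t2 in linarith)
  ultimately have "\<forall>\<^sub>F s in at_right 0. ereal (q0 / t\<^sup>2) < q_fun f s" "\<forall>\<^sub>F s in at_right 0. q_fun f s < ereal (q0 * t\<^sup>2)"
    "\<forall>\<^sub>F s in at_top. q_fun f s < ereal (q1 * t\<^sup>2)"
    using order_tendstoD[OF lim] Limsup_lessD[of at_top "q_fun f"] qinf by auto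
  then have "\<forall>\<^sub>F s in at_right 0. ereal (q0 / t\<^sup>2) < q_fun f s \<and> q_fun f s < ereal (q0 * t\<^sup>2)"
    "\<forall>\<^sub>F s in at_top. q_fun f s < ereal (q1 * t\<^sup>2)"
    by (auto intro: eventually_conj)
  then obtain d b0 where d: "0 < d" "\<And>s. 0 < s \<Longrightarrow> s < d \<Longrightarrow> ereal (q0 / t\<^sup>2) < q_fun f s \<and> q_fun f s < ereal (q0 * t\<^sup>2)"
    and b0: "\<And>s. b0 \<le> s \<Longrightarrow> q_fun f s < ereal (q1 * t\<^sup>2)"
    by (auto simp: eventually_at_right_field eventually_at_top_linorder)
  define a where "a = d / 2"
  define b where "b = max a b0"
  have a: "0 < a" "a < d" "a \<le> b" "b0 \<le> b" using d by (auto simp: a_def b_def)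
  define \<alpha>0 where "\<alpha>0 = 1 + 1 / (t\<^sup>2 * sqrt q0)"
  define \<alpha>1 where "\<alpha>1 = 1 + 1 / (t\<^sup>2 * sqrt q1)"
  define r0 where "r0 = 1 / (q0 * t\<^sup>2)"
  define r1 where "r1 = 1 / (q1 * t\<^sup>2)"
  define r2 where "r2 = 1 / (q0 / t\<^sup>2)"
  \<comment> \<open>With \<open>T = t^2\<close> the left side is
    \<open>(\<alpha> - 1)^2 = 1 / (q * T^2)\<close>, smaller by a factor \<open>T\<close> than
    \<open>r0\<close> or \<open>r1\<close>.\<close>
  have sq: "(1 / (T * sqrt q))\<^sup>2 < 1 / (q * T)" if "1 \<le> q" "1 < T" for q T
  proof -
    have "(1 / (T * sqrt q))\<^sup>2 = 1 / (q * T * T)"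
      using that by (simp add: power_divide power_mult_distrib power2_eq_square)
    also have "\<dots> < 1 / (q * T)"
      using that by (intro divide_strict_left_mono) auto
    finally show ?thesis .
  qed
  interpret interpolated_test_function f "deriv f" "deriv (deriv f)" a b \<alpha>0 \<alpha>1 r0 r1
  proof
    show "f 0 = 0" "0 < a" "a \<le> b" using f0 a by auto
    show "r0 * (deriv f s)\<^sup>2 \<le> f s * deriv (deriv f) s" if "0 < s" "s \<le> a" for s
      unfolding r0_def using that a d(2) by (intro nonlinearity_q_less(3)[OF nl _ _ tp(1)]) auto
    show "r1 * (deriv f s)\<^sup>2 \<le> f s * deriv (deriv f) s" if "b \<le> s" for s
      unfolding r1_def using that a b0 by (intro nonlinearity_q_less(3)[OF nl _ _ tp(2)]) auto
    show "1 < \<alpha>0" "1 \<le> \<alpha>1" using q0 q1 t(1) by (auto simp: \<alpha>0_def \<alpha>1_def)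
    show "(\<alpha>0 - 1)\<^sup>2 < r0" "(\<alpha>1 - 1)\<^sup>2 < r1"
      using sq[OF q0 t2] sq[OF q1 t2] by (simp_all add: \<alpha>0_def \<alpha>1_def r0_def r1_def)
  qed
  have r2: "0 < r2" unfolding r2_def by (intro divide_pos_pos zero_less_one tp)
  have near: "f s * deriv (deriv f) s \<le> r2 * (deriv f s)\<^sup>2" if "0 < s" "s \<le> a" for s
    unfolding r2_def using that a d(2) by (intro nonlinearity_q_greater[OF nl _ _ tp(3)]) auto
  obtain c where c: "0 < c" "\<And>s. 0 \<le> s \<Longrightarrow>
    c * (\<psi> s)\<^sup>2 powr (1 + r2 / (2 * \<alpha>0)) \<le> \<Psi> s \<or> c * (\<psi> s)\<^sup>2 powr (1 + r1 / (2 * \<alpha>1)) \<le> \<Psi> s"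
    using \<Psi>_growth[OF r2 near] by blast
  obtain G \<Xi> \<epsilon> where G: "\<And>s. (G has_real_derivative (\<psi>' s)\<^sup>2) (at s)" "\<And>s. (\<Xi> has_real_derivative G s) (at s)"
    "0 < \<epsilon>" "\<And>s. 0 \<le> s \<Longrightarrow> f s * G s \<le> (1 - \<epsilon>) * \<Psi> s"
    "\<And>s. 0 \<le> s \<Longrightarrow> \<bar>(\<psi> s)\<^sup>2 / 2 - \<Xi> s\<bar> \<le> (\<psi> s)\<^sup>2 / 2"
    using test_functions by blast
  have C1u: "C1 u" using sol by (auto simp: solution_def intro: C2_C1)
  have \<Psi>_eq: "\<Psi> s = nonlin_deriv f s * (\<psi> s)\<^sup>2" if "0 \<le> s" for s
    using that by (cases "s = 0") (auto simp: \<Psi>_def nonlin_deriv_def \<psi>_0)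
  have comp: "continuous_on UNIV (\<lambda>x. g (u x))" if "continuous_on UNIV g" for g :: "real \<Rightarrow> real"
    using continuous_on_compose2[OF that C1_continuous[OF C1u]] by simp
  have c\<psi>: "continuous_on UNIV \<psi>" by (rule DERIV_continuous_on[OF has_field_derivative_at_within[OF deriv_\<psi>]])
  have "\<Psi> (u x) = 0"
  proof (rule vanishing_of_cutoff_estimate[where A="\<lambda>x. \<Psi> (u x)" and X="\<lambda>x. (\<psi> (u x))\<^sup>2" and c=c
        and ?d1.0="r2 / (2 * \<alpha>0)" and ?d2.0="r1 / (2 * \<alpha>1)"])
    show "continuous_on UNIV (\<lambda>x. \<Psi> (u x))" by (intro comp continuous_\<Psi>)
    show "continuous_on UNIV (\<lambda>x. (\<psi> (u x))\<^sup>2)" by (intro continuous_intros comp c\<psi>)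
    show "0 \<le> \<Psi> (u x)" for x using deriv1_nonneg by (simp add: \<Psi>_def)
    have "0 < r1" unfolding r1_def by (intro divide_pos_pos zero_less_one tp)
    then show "0 < r2 / (2 * \<alpha>0)" "0 < r1 / (2 * \<alpha>1)" using r2 \<alpha>0 \<alpha>1 by simp_all
    show "real CARD('n) < 2 * (1 + 1 / (r2 / (2 * \<alpha>0)))"
      using t(2) by (simp add: r2_def \<alpha>0_def mult.commute[of q0])
    \<comment> \<open>At infinity the tolerance works in favour: having \<open>q1 * t^2\<close>
      instead of \<open>q1\<close> in \<open>r1\<close> only enlarges the admissible dimension, so
      any \<open>t > 1\<close> will do.\<close>
    have "real CARD('n) < 2 + 4 * (q1 * t\<^sup>2) + 4 * sqrt q1"
      using dim(2) less(2) by linarith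
    also have "\<dots> = 2 + 4 * (q1 * t\<^sup>2) + 4 * (q1 / sqrt q1)" using q1 by (simp add: real_div_sqrt)
    also have "\<dots> = 2 * (1 + 1 / (r1 / (2 * \<alpha>1)))"
      using q1 t(1) by (simp add: r1_def \<alpha>1_def field_simps)
    finally show "real CARD('n) < 2 * (1 + 1 / (r1 / (2 * \<alpha>1)))" .
    show "\<exists>K. \<forall>R\<ge>1. (LINT x|lborel. \<Psi> (u x) * cutoff R (2 * k) x)
        \<le> K / R\<^sup>2 * (LINT x|lborel. (\<psi> (u x))\<^sup>2 * cutoff R (2 * k - 2) x)" if "3 \<le> k" for k
      using stability_cutoff_estimate[OF u sol stable deriv_\<psi> continuous_\<psi>' G(1,2) \<Psi>_eq continuous_\<Psi> G(3,4,5) that]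
      by blast
  qed (use c u in auto)
  moreover have "0 < \<Psi> (u x)" if "0 < u x"
    using that \<psi>_pos[OF that] deriv_pos[OF f0 that] by (simp add: \<Psi>_def)
  ultimately show ?thesis using u[of x] by fastforce
qed

theorem corollary1p7:
  fixes f :: "real \<Rightarrow> real" and u :: "real ^ 'n::finite \<Rightarrow> real"
    and N :: nat and q\<^sub>0 p\<^sub>0 p_inf :: ereal
  assumes dim: "N = CARD('n)"
    and f_C0: "continuous_on {0..} f"
    and f_C2: "f C1_differentiable_on {0<..}" "deriv f C1_differentiable_on {0<..}"
    and f_mono: "mono_on {0..} f"
    and f_convex: "convex_on {0..} f"
    and f_pos: "\<And>s. s > 0 \<Longrightarrow> f s > 0"
    and q0: "(q_fun f \<longlongrightarrow> q\<^sub>0) (at_right 0)"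
    and p0: "p\<^sub>0 = conj_exponent q\<^sub>0"
    and p_inf: "p_inf = conj_exponent (Limsup at_top (q_fun f))"
    and u_nonneg: "\<And>x. u x \<ge> 0"
    and u_sol: "solution f u"
    and u_stable: "is_stable f u"
    and cases: "(1 \<le> N \<and> N \<le> 9 \<and> 1 < p_inf)
      \<or> (N = 10 \<and> p\<^sub>0 < \<infinity> \<and> 1 < p_inf \<and> p_inf < \<infinity>)
      \<or> (11 \<le> N \<and> p\<^sub>0 < ereal (p_c N) \<and> 1 < p_inf \<and> p_inf < ereal (p_c N))"
  shows "\<forall>x. u x = 0"
proof
  fix x
  have nl: "nonlinearity f (deriv f) (deriv (deriv f))"
    using f_C0 f_C2 f_mono f_convex f_pos by (rule nonlinearity_deriv)
  interpret nonlinearity f "deriv f" "deriv (deriv f)" by fact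
  \<comment> \<open>All three cases contain \<open>1 < p_inf\<close>, which makes the upper limit at
    infinity finite and at least 1.\<close>
  have "1 < conj_exponent (Limsup at_top (q_fun f))" using cases p_inf by auto
  then obtain q1 where q1: "Limsup at_top (q_fun f) = ereal q1" "1 \<le> q1"
    by (rule conj_exponent_gt_1)
  \<comment> \<open>For \<open>f 0 > 0\<close> or infinite \<open>q\<^sub>0\<close> the nonlinearity
    dominates powers close to 1; otherwise the interpolated test function applies, whose
    construction requires \<open>f 0 = 0\<close>.\<close>
  consider "0 < f 0 \<or> (f 0 = 0 \<and> q\<^sub>0 = \<infinity>)" | "f 0 = 0" "q\<^sub>0 \<noteq> \<infinity>"
    using nonneg_0 by fastforce
  then show "u x = 0"
  proof cases
    case 1
    then show ?thesis
      using q1 by (intro trivial_solution_superlinear[OF nl q0 _ _ u_nonneg u_sol]) auto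
  next
    case 2
    then obtain q where q: "q\<^sub>0 = ereal q" "1 \<le> q"
      using nonlinearity_q0_ge_1[OF nl 2(1) q0] by (cases q\<^sub>0) (auto simp: one_ereal_def)
    \<comment> \<open>The dimension condition is used at both ends: \<open>q\<close> carries the
      assumption on \<open>p\<^sub>0\<close> and \<open>q1\<close> that on \<open>p_inf\<close>. For
      \<open>N \<le> 9\<close> it holds for all exponents at least 1.\<close>
    have "real N < 2 + 4 * q + 4 * sqrt q" "real N < 2 + 4 * q1 + 4 * sqrt q1"
      using cases p0 p_inf q q1 by (auto intro!: dimension_bound)
    then show ?thesis
      using 2 q q0 dim by (intro trivial_solution_stable[OF nl _ _ _ q1 _ _ u_nonneg u_sol u_stable]) auto
  qed
qed

end
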